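(* Let $l\ge 1$ and let $\Gamma_1,\ldots,\Gamma_l$ be finite, non-empty, connected graphs with $k_1,\ldots,k_l$ vertices respectively, and let $\Gamma_J$ be their join. Let $k=\sum_{i=1}^l k_i$ be the number of vertices of $\Gamma_J$. Then \[ |\operatorname{Pic}^0(\Gamma_J)| = k^{l-2}\prod_{i=1}^{l}|P_{\Gamma_i}(k_i-k)|, \] where $P_{\Gamma_i}(x)$ is the characteristic polynomial of the rational Laplacian operator of $\Gamma_i$.
   Context: The join of graphs $\Gamma_1,\dots,\Gamma_l$ is obtained from their disjoint union by adding an edge between every vertex of $\Gamma_i$ and every vertex of $\Gamma_j$ for all $i\neq j$. For a graph $\Gamma$, $\operatorname{Div}(\Gamma)$ is the free abelian group on $V(\Gamma)$, $\operatorname{Div}^0(\Gamma)$ is the kernel of the degree map $\sum a_v v\mapsto \sum a_v$, the Laplacian $\Delta(\Gamma):\operatorname{Div}(\Gamma)\to\operatorname{Div}^0(\Gamma)$ is given by $v\mapsto (\deg v)\,v-\sum_{wv\in E(\Gamma)} w$, and $\operatorname{Pic}^0(\Gamma)=\operatorname{Div}^0(\Gamma)/\operatorname{im}\Delta(\Gamma)$. The rational Laplacian operator is the endomorphism of $\operatorname{Div}^0(\Gamma)\otimes_{\mathbb{Z}}\mathbb{Q}$ induced by $\Delta(\Gamma)$, and $P_\Gamma(x)$ is its characteristic polynomial, with the convention $P_\Gamma(x)=1$ if $\Gamma$ has one vertex. *)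

theory Defs
  imports
    "Graph_Theory.Graph_Theory"
    "Jordan_Normal_Form.Char_Poly"
    "HOL-Algebra.Free_Abelian_Groups"
begin

text \<open>
  A finite simple graph is a \<open>pair_graph\<close>: a finite, loop-free digraph whose arc set is a
  symmetric relation, the edge \<open>wv\<close> being represented by the two arcs \<open>(w,v)\<close> and \<open>(v,w)\<close>.
\<close>

definition graph_join :: "nat \<Rightarrow> (nat \<Rightarrow> 'a pair_pre_digraph) \<Rightarrow> (nat \<times> 'a) pair_pre_digraph" where
  "graph_join l \<Gamma> =
    \<lparr> pverts = (SIGMA i:{1..l}. pverts (\<Gamma> i)),
      parcs = {((i, u), (i, v)) | i u v. i \<in> {1..l} \<and> (u, v) \<in> parcs (\<Gamma> i)}
            \<union> {((i, u), (j, v)) | i j u v. i \<in> {1..l} \<and> j \<in> {1..l} \<and> i \<noteq> j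
                 \<and> u \<in> pverts (\<Gamma> i) \<and> v \<in> pverts (\<Gamma> j)} \<rparr>"

definition Div :: "'a pair_pre_digraph \<Rightarrow> ('a \<Rightarrow>\<^sub>0 int) monoid" where
  "Div G = free_Abelian_group (pverts G)"

definition div_degree :: "('a \<Rightarrow>\<^sub>0 int) \<Rightarrow> int" where
  "div_degree D = (\<Sum>v\<in>Poly_Mapping.keys D. Poly_Mapping.lookup D v)"

definition Div0 :: "'a pair_pre_digraph \<Rightarrow> ('a \<Rightarrow>\<^sub>0 int) monoid" where
  "Div0 G = (Div G)\<lparr>carrier := kernel (Div G) integer_group div_degree\<rparr>"

definition laplacian :: "'a pair_pre_digraph \<Rightarrow> ('a \<Rightarrow>\<^sub>0 int) \<Rightarrow> ('a \<Rightarrow>\<^sub>0 int)" where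
  "laplacian G = frag_extend (\<lambda>v.
     frag_cmul (int (out_degree (with_proj G) v)) (frag_of v)
       - (\<Sum>w | (w, v) \<in> parcs G. frag_of w))"

definition Pic0 :: "'a pair_pre_digraph \<Rightarrow> ('a \<Rightarrow>\<^sub>0 int) set monoid" where
  "Pic0 G = Div0 G Mod (laplacian G ` carrier (Div G))"

text \<open>
  \<open>Div(\<Gamma>) \<otimes> \<rat>\<close> is the \<open>\<rat>\<close>-vector space with basis \<open>V(\<Gamma>)\<close>, realised inside \<open>'a \<Rightarrow>\<^sub>0 rat\<close>;
  \<open>rat_div D\<close> is \<open>D \<otimes> 1\<close>.
\<close>

definition rat_scale :: "rat \<Rightarrow> ('a \<Rightarrow>\<^sub>0 rat) \<Rightarrow> ('a \<Rightarrow>\<^sub>0 rat)" where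
  "rat_scale c = Poly_Mapping.map ((*) c)"

definition rat_div :: "('a \<Rightarrow>\<^sub>0 int) \<Rightarrow> ('a \<Rightarrow>\<^sub>0 rat)" where
  "rat_div = Poly_Mapping.map of_int"

lemma lookup_rat_scale [simp]:
  "Poly_Mapping.lookup (rat_scale c x) v = c * Poly_Mapping.lookup x v"
  by (simp add: rat_scale_def Poly_Mapping.map.rep_eq when_def)

lemma lookup_rat_div [simp]:
  "Poly_Mapping.lookup (rat_div D) v = of_int (Poly_Mapping.lookup D v)"
  by (simp add: rat_div_def Poly_Mapping.map.rep_eq when_def)

interpretation ratvs: vector_space rat_scale
  by unfold_locales (auto intro!: poly_mapping_eqI simp: lookup_add algebra_simps)

text \<open>
  By flatness of \<open>\<rat>\<close>, \<open>Div\<^sup>0(\<Gamma>) \<otimes> \<rat>\<close> embeds into \<open>Div(\<Gamma>) \<otimes> \<rat>\<close>, with image the \<open>\<rat>\<close>-span of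
  the elements \<open>D \<otimes> 1\<close>; this image is taken as its definition. The lemmas \<open>inj_rat_div\<close> and
  \<open>Div0_rat_clear_denominators\<close> below say that it is the localisation of \<open>Div\<^sup>0(\<Gamma>)\<close> at the
  nonzero integers.
\<close>

definition Div0_rat :: "'a pair_pre_digraph \<Rightarrow> ('a \<Rightarrow>\<^sub>0 rat) set" where
  "Div0_rat G = ratvs.span (rat_div ` carrier (Div0 G))"

definition rat_laplacian :: "'a pair_pre_digraph \<Rightarrow> ('a \<Rightarrow>\<^sub>0 rat) \<Rightarrow> ('a \<Rightarrow>\<^sub>0 rat)" where
  "rat_laplacian G x =
     (\<Sum>v\<in>Poly_Mapping.keys x. rat_scale (Poly_Mapping.lookup x v) (rat_div (laplacian G (frag_of v))))"

text \<open>
  The characteristic polynomial of an endomorphism \<open>f\<close> of a finite-dimensional subspace \<open>W\<close>,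
  computed in an arbitrary ordered basis of \<open>W\<close>. For \<open>W = 0\<close> the matrix has size \<open>0\<close> and the
  polynomial is \<open>1\<close>.
\<close>

definition is_ordered_basis :: "('a \<Rightarrow>\<^sub>0 rat) list \<Rightarrow> ('a \<Rightarrow>\<^sub>0 rat) set \<Rightarrow> bool" where
  "is_ordered_basis bs W \<longleftrightarrow>
     distinct bs \<and> ratvs.independent (set bs) \<and> ratvs.span (set bs) = W"

definition endo_matrix ::
    "('a \<Rightarrow>\<^sub>0 rat) list \<Rightarrow> (('a \<Rightarrow>\<^sub>0 rat) \<Rightarrow> ('a \<Rightarrow>\<^sub>0 rat)) \<Rightarrow> rat mat" where
  "endo_matrix bs f =
     mat (length bs) (length bs) (\<lambda>(i, j). ratvs.representation (set bs) (f (bs ! j)) (bs ! i))"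

definition endo_char_poly ::
    "('a \<Rightarrow>\<^sub>0 rat) set \<Rightarrow> (('a \<Rightarrow>\<^sub>0 rat) \<Rightarrow> ('a \<Rightarrow>\<^sub>0 rat)) \<Rightarrow> rat poly" where
  "endo_char_poly W f = char_poly (endo_matrix (SOME bs. is_ordered_basis bs W) f)"

definition graph_char_poly :: "'a pair_pre_digraph \<Rightarrow> rat poly" where
  "graph_char_poly G = endo_char_poly (Div0_rat G) (rat_laplacian G)"

lemma rat_div_add: "rat_div (D + E) = rat_div D + rat_div E"
  by (rule poly_mapping_eqI) (simp add: lookup_add)

lemma rat_div_diff: "rat_div (D - E) = rat_div D - rat_div E"
  by (rule poly_mapping_eqI) (simp add: lookup_minus)

lemma rat_div_zero [simp]: "rat_div 0 = 0"
  by (rule poly_mapping_eqI) simp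

lemma rat_div_cmul: "rat_div (frag_cmul c D) = rat_scale (of_int c) (rat_div D)"
  by (rule poly_mapping_eqI) simp

lemma inj_rat_div: "inj rat_div"
  by (rule injI) (metis lookup_rat_div of_int_eq_iff poly_mapping_eqI)

lemma keys_rat_div [simp]: "Poly_Mapping.keys (rat_div D) = Poly_Mapping.keys D"
  by (auto simp: in_keys_iff)

lemma div_degree_superset:
  assumes "finite A" "Poly_Mapping.keys D \<subseteq> A"
  shows "div_degree D = (\<Sum>v\<in>A. Poly_Mapping.lookup D v)"
  unfolding div_degree_def using assms
  by (intro sum.mono_neutral_left) (auto simp: in_keys_iff)

lemma div_degree_add: "div_degree (D + E) = div_degree D + div_degree E"
proof -
  let ?A = "Poly_Mapping.keys D \<union> Poly_Mapping.keys E"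
  show ?thesis
    using keys_add[of D E]
    by (simp add: div_degree_superset[of ?A] lookup_add sum.distrib)
qed

lemma div_degree_cmul: "div_degree (frag_cmul c D) = c * div_degree D"
  using keys_cmul[of c D]
  by (simp add: div_degree_superset[of "Poly_Mapping.keys D"] sum_distrib_left)

lemma div_degree_uminus: "div_degree (- D) = - div_degree D"
  using div_degree_cmul[of "-1" D] by simp

lemma div_degree_diff: "div_degree (D - E) = div_degree D - div_degree E"
  using div_degree_add[of D "- E"] by (simp add: div_degree_uminus)

lemma div_degree_zero [simp]: "div_degree 0 = 0"
  by (simp add: div_degree_def)

lemma div_degree_frag_of [simp]: "div_degree (frag_of v) = 1"
  by (simp add: div_degree_def)

lemma div_degree_sum: "div_degree (sum f A) = (\<Sum>a\<in>A. div_degree (f a))"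
  by (induction A rule: infinite_finite_induct) (auto simp: div_degree_add)

lemma carrier_Div: "carrier (Div G) = {D. Poly_Mapping.keys D \<subseteq> pverts G}"
  by (auto simp: Div_def)

lemma carrier_Div0: "carrier (Div0 G) = {D. Poly_Mapping.keys D \<subseteq> pverts G \<and> div_degree D = 0}"
  by (auto simp: Div0_def kernel_def carrier_Div)

lemma Div0_rat_clear_denominators:
  assumes "x \<in> Div0_rat G"
  shows "\<exists>n D. n > 0 \<and> D \<in> carrier (Div0 G) \<and> rat_scale (of_int n) x = rat_div D"
  using assms unfolding Div0_rat_def
proof (induction rule: ratvs.span_induct_alt)
  case base
  show ?case
    by (rule exI[of _ 1], rule exI[of _ 0]) (auto simp: carrier_Div0)
next
  case (step c y z)
  then obtain n D E where n: "n > 0" "D \<in> carrier (Div0 G)" "rat_scale (of_int n) z = rat_div D"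
    and E: "E \<in> carrier (Div0 G)" "y = rat_div E"
    by blast
  obtain p q where "quotient_of c = (p, q)"
    by (cases "quotient_of c")
  then have pq: "q > 0" "c = of_int p / of_int q"
    by (auto simp: quotient_of_denom_pos quotient_of_div)
  let ?F = "frag_cmul (n * p) E + frag_cmul q D"
  have D: "of_int n * Poly_Mapping.lookup z v = of_int (Poly_Mapping.lookup D v)" for v
    using n(3) by (metis lookup_rat_scale lookup_rat_div)
  have "rat_scale (of_int (n * q)) (rat_scale c y + z) = rat_div ?F"
    using pq by (intro poly_mapping_eqI) (simp add: E(2) lookup_add field_simps flip: D)
  moreover have "?F \<in> carrier (Div0 G)"
    using n(2) E(1) keys_add[of "frag_cmul (n * p) E" "frag_cmul q D"]
      keys_cmul[of "n * p" E] keys_cmul[of q D]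
    by (auto simp: carrier_Div0 div_degree_add div_degree_cmul)
  ultimately show ?case
    using n(1) pq(1) by (intro exI[of _ "n * q"] exI[of _ ?F]) simp
qed

lemma rat_laplacian_superset:
  assumes "finite A" "Poly_Mapping.keys x \<subseteq> A"
  shows "rat_laplacian G x =
    (\<Sum>v\<in>A. rat_scale (Poly_Mapping.lookup x v) (rat_div (laplacian G (frag_of v))))"
  unfolding rat_laplacian_def using assms
  by (intro sum.mono_neutral_left) (auto simp: in_keys_iff)

lemma linear_rat_laplacian: "Vector_Spaces.linear rat_scale rat_scale (rat_laplacian G)"
proof (unfold_locales, goal_cases)
  case (1 x y)
  let ?A = "Poly_Mapping.keys x \<union> Poly_Mapping.keys y"
  show ?case
    using keys_add[of x y]
    by (simp add: rat_laplacian_superset[of ?A] lookup_add ratvs.scale_left_distrib sum.distrib)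
next
  case (2 c x)
  have "Poly_Mapping.keys (rat_scale c x) \<subseteq> Poly_Mapping.keys x"
    by (auto simp: in_keys_iff)
  then show ?case
    by (simp add: rat_laplacian_superset[of "Poly_Mapping.keys x"] ratvs.scale_sum_right)
qed

lemma rat_laplacian_rat_div: "rat_laplacian G (rat_div D) = rat_div (laplacian G D)"
proof -
  have *: "rat_div (sum f A) = (\<Sum>a\<in>A. rat_div (f a))" for f :: "'b \<Rightarrow> ('a \<Rightarrow>\<^sub>0 int)" and A
    by (induction A rule: infinite_finite_induct) (auto simp: rat_div_add)
  show ?thesis
    by (simp add: rat_laplacian_def laplacian_def frag_extend_def[of _ D] * rat_div_cmul)
qed

lemma (in pair_graph) laplacian_in_Div0:
  assumes "D \<in> carrier (Div G)"
  shows "laplacian G D \<in> carrier (Div0 G)"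
proof -
  let ?d = "\<lambda>v. frag_cmul (int (out_degree (with_proj G) v)) (frag_of v)
       - (\<Sum>w | (w, v) \<in> parcs G. frag_of w)"
  have deg: "out_degree (with_proj G) v = card {w. (w, v) \<in> parcs G}" for v
  proof -
    have "out_arcs (with_proj G) v = Pair v ` {w. (w, v) \<in> parcs G}"
      using pair_sym_arcs by (auto simp: out_arcs_def symmetric_def dest: symD)
    then show ?thesis
      by (simp add: out_degree_def card_image inj_on_def)
  qed
  have "div_degree (?d v) = 0" for v
    by (simp add: div_degree_diff div_degree_cmul div_degree_sum deg)
  then have "div_degree (laplacian G D) = 0"
    by (simp add: laplacian_def frag_extend_def div_degree_sum div_degree_cmul)
  moreover have "Poly_Mapping.keys (?d v) \<subseteq> pverts G" if "v \<in> pverts G" for v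
  proof -
    have "Poly_Mapping.keys (\<Sum>w | (w, v) \<in> parcs G. frag_of w) \<subseteq> pverts G"
      using keys_sum[of frag_of "{w. (w, v) \<in> parcs G}"] by (auto dest: in_arcsD1)
    then show ?thesis
      using that keys_cmul[of "int (out_degree (with_proj G) v)" "frag_of v"]
      by (intro order_trans[OF keys_diff] Un_least) (auto simp: keys_frag_of)
  qed
  then have "Poly_Mapping.keys (laplacian G D) \<subseteq> pverts G"
    using assms keys_frag_extend[of ?d D] unfolding laplacian_def carrier_Div by blast
  ultimately show ?thesis
    by (simp add: carrier_Div0)
qed

lemma (in pair_graph) rat_laplacian_in_Div0_rat:
  assumes "x \<in> Div0_rat G"
  shows "rat_laplacian G x \<in> Div0_rat G"
proof -
  interpret L: Vector_Spaces.linear rat_scale rat_scale "rat_laplacian G"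
    by (rule linear_rat_laplacian)
  have "rat_laplacian G ` rat_div ` carrier (Div0 G) \<subseteq> rat_div ` carrier (Div0 G)"
    using laplacian_in_Div0 by (auto simp: rat_laplacian_rat_div carrier_Div carrier_Div0)
  then have "rat_laplacian G ` Div0_rat G \<subseteq> Div0_rat G"
    unfolding Div0_rat_def L.span_image[symmetric] by (rule ratvs.span_mono)
  then show ?thesis
    using assms by blast
qed

lemma Div0_rat_ordered_basis:
  assumes "finite (pverts G)"
  shows "\<exists>bs. is_ordered_basis bs (Div0_rat G)"
proof -
  obtain B where B: "B \<subseteq> Div0_rat G" "ratvs.independent B" "Div0_rat G \<subseteq> ratvs.span B"
    by (rule ratvs.basis_exists) blast
  have span: "ratvs.span B = Div0_rat G"
    using B ratvs.span_minimal[OF B(1)] by (auto simp: Div0_rat_def)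
  let ?S = "(\<lambda>v. rat_div (frag_of v)) ` pverts G"
  have "rat_div D \<in> ratvs.span ?S" if "D \<in> carrier (Div0 G)" for D
  proof -
    have "Poly_Mapping.keys D \<subseteq> pverts G"
      using that by (simp add: carrier_Div0)
    then show ?thesis
      by (rule free_Abelian_group_induct)
        (auto simp: rat_div_diff intro: ratvs.span_base ratvs.span_zero ratvs.span_diff)
  qed
  then have "Div0_rat G \<subseteq> ratvs.span ?S"
    unfolding Div0_rat_def by (intro ratvs.span_minimal) auto
  then have "finite B"
    using ratvs.independent_span_bound[of ?S B] assms B(1,2) by blast
  then obtain bs where "set bs = B" "distinct bs"
    using finite_distinct_list by blast
  then show ?thesis
    using B(2) span unfolding is_ordered_basis_def by blast
qed

lemma graph_char_poly_one_vertex: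
  assumes "pverts G = {v}"
  shows "graph_char_poly G = 1"
proof -
  have "D = 0" if "Poly_Mapping.keys D \<subseteq> {v}" "div_degree D = 0" for D :: "'a \<Rightarrow>\<^sub>0 int"
  proof (rule poly_mapping_eqI)
    fix w
    show "Poly_Mapping.lookup D w = Poly_Mapping.lookup 0 w"
      using that div_degree_superset[of "{v}" D] by (cases "w = v") (auto simp: in_keys_iff)
  qed
  then have "carrier (Div0 G) \<subseteq> {0}"
    by (auto simp: carrier_Div0 assms)
  then have W: "Div0_rat G \<subseteq> {0}"
    unfolding Div0_rat_def by (intro ratvs.span_minimal) auto
  have "is_ordered_basis (SOME bs. is_ordered_basis bs (Div0_rat G)) (Div0_rat G)"
    using Div0_rat_ordered_basis[of G] assms by (auto intro: someI_ex)
  moreover have "bs = []" if "is_ordered_basis bs (Div0_rat G)" for bs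
  proof -
    have "set bs \<subseteq> {0}" "0 \<notin> set bs"
      using that W ratvs.span_superset[of "set bs"] ratvs.dependent_zero[of "set bs"]
      by (auto simp: is_ordered_basis_def)
    then show ?thesis by (cases bs) auto
  qed
  ultimately have "(SOME bs. is_ordered_basis bs (Div0_rat G)) = []"
    by blast
  then show ?thesis
    by (simp add: graph_char_poly_def endo_char_poly_def endo_matrix_def char_poly_def
        char_poly_matrix_def)
qed

end

theory Submission
  imports Defs
begin

text \<open>
  Let \<open>L\<close> be the Laplacian matrix of a connected graph on \<open>n\<close> vertices and \<open>J\<close> the all-ones matrix.
  The choice of a root vertex identifies \<open>Pic\<^sup>0\<close> with the cokernel over the integers of the reduced
  Laplacian, which is nonsingular by the maximum principle for harmonic functions; so \<open>|Pic\<^sup>0|\<close> is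
  the absolute value of its determinant, and row and column operations show
  \<open>det (L + J) = n\<^sup>2 det L\<^sub>r\<^sub>e\<^sub>d\<close>. More generally all column sums of \<open>L + c I + J\<close> are \<open>c + n\<close>, and
  splitting off this factor leaves the matrix of \<open>L + c\<close> on \<open>Div\<^sup>0\<close> in the basis of differences
  with the root; hence \<open>det (L + c I + J) = \<plusminus>(c + n) P(-c)\<close>.
  For the join of the \<open>\<Gamma>\<^sub>i\<close>, the matrix \<open>L + J\<close> is block diagonal with blocks
  \<open>L\<^sub>i + (k - k\<^sub>i) I + J\<close>. Therefore \<open>k\<^sup>2 |Pic\<^sup>0| = \<Prod> k |P\<^sub>i(k\<^sub>i - k)|\<close>.
\<close>

section \<open>Quotient groups and transversals\<close>

lemma (in group_hom) FactGroup_vimage_iso: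
  assumes surj: "h ` carrier G = carrier H" and "N \<lhd> H"
  shows "G Mod {x \<in> carrier G. h x \<in> N} \<cong> H Mod N"
proof -
  interpret N: normal N H by fact
  let ?q = "\<lambda>x. N #>\<^bsub>H\<^esub> h x"
  interpret q: group_hom G "H Mod N" ?q
    using Group.hom_compose[OF homh N.r_coset_hom_Mod] N.factorgroup_is_group
    by (simp add: group_hom_def group_hom_axioms_def comp_def)
  have "\<one>\<^bsub>H Mod N\<^esub> = N"
    by (simp add: FactGroup_def)
  moreover have "N #>\<^bsub>H\<^esub> y = N \<longleftrightarrow> y \<in> N" if "y \<in> carrier H" for y
    using that H.coset_join1 H.coset_join2 N.subgroup_axioms N.subset by blast
  ultimately have "kernel G (H Mod N) ?q = {x \<in> carrier G. h x \<in> N}"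
    by (simp add: kernel_def cong: conj_cong)
  moreover have "?q ` carrier G = carrier (H Mod N)"
    unfolding FactGroup_def RCOSETS_def by (auto simp flip: surj)
  ultimately show ?thesis
    using q.FactGroup_iso by simp
qed

definition right_transversal :: "('a, 'b) monoid_scheme \<Rightarrow> 'a set \<Rightarrow> 'a set \<Rightarrow> bool" where
  "right_transversal G H T \<longleftrightarrow>
     T \<subseteq> carrier G \<and> (\<forall>x\<in>carrier G. \<exists>!t. t \<in> T \<and> x \<in> H #>\<^bsub>G\<^esub> t)"

lemma (in group) bij_betw_right_transversal:
  assumes H: "subgroup H G" and T: "right_transversal G H T"
  shows "bij_betw (\<lambda>t. H #> t) T (rcosets H)"
proof (rule bij_betw_imageI)
  have TG: "T \<subseteq> carrier G"
    and unique: "\<And>x. x \<in> carrier G \<Longrightarrow> \<exists>!t. t \<in> T \<and> x \<in> H #> t"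
    using T by (auto simp: right_transversal_def)
  show "inj_on (\<lambda>t. H #> t) T"
  proof (rule inj_onI)
    fix t t' assume "t \<in> T" "t' \<in> T" "H #> t = H #> t'"
    then show "t = t'"
      using unique[of t] rcos_self[OF _ H, of t] TG by blast
  qed
  show "(\<lambda>t. H #> t) ` T = rcosets H"
  proof
    show "(\<lambda>t. H #> t) ` T \<subseteq> rcosets H"
      using TG by (auto simp: RCOSETS_def)
    show "rcosets H \<subseteq> (\<lambda>t. H #> t) ` T"
    proof
      fix X assume "X \<in> rcosets H"
      then obtain x where x: "x \<in> carrier G" "X = H #> x"
        by (auto simp: RCOSETS_def)
      then obtain t where "t \<in> T" "x \<in> H #> t"
        using unique by blast
      then show "X \<in> (\<lambda>t. H #> t) ` T"
        using repr_independence[OF _ _ H] TG x by blast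
    qed
  qed
qed

section \<open>Cokernels of integer matrices\<close>

definition mat_range :: "'a :: comm_ring_1 mat \<Rightarrow> 'a vec set" where
  "mat_range A = (*\<^sub>v) A ` carrier_vec (dim_col A)"

definition mat_cokernel :: "'a :: comm_ring_1 mat \<Rightarrow> 'a vec set monoid" where
  "mat_cokernel A = monoid_vec TYPE('a) (dim_row A) Mod mat_range A"

lemma subgroup_mat_range:
  fixes A :: "'a :: comm_ring_1 mat"
  shows "subgroup (mat_range A) (monoid_vec TYPE('a) (dim_row A))"
proof -
  let ?n = "dim_col A"
  interpret V: comm_group "monoid_vec TYPE('a) (dim_row A)"
    by (rule comm_group_vec)
  have A: "A \<in> carrier_mat (dim_row A) ?n"
    by simp
  show ?thesis
  proof (rule V.subgroupI)
    show "mat_range A \<subseteq> carrier (monoid_vec TYPE('a) (dim_row A))"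
      using mult_mat_vec_carrier[OF A] by (auto simp: mat_range_def monoid_vec_simps)
    show "mat_range A \<noteq> {}"
      by (auto simp: mat_range_def intro: zero_carrier_vec)
  next
    fix x assume "x \<in> mat_range A"
    then obtain z where z: "z \<in> carrier_vec ?n" "x = A *\<^sub>v z"
      by (auto simp: mat_range_def)
    have "A *\<^sub>v (- z) + x = A *\<^sub>v (- z + z)"
      using z mult_add_distrib_mat_vec[OF A, of "- z" z] by simp
    also have "\<dots> = 0\<^sub>v (dim_row A)"
      using z(1) by auto
    finally have "inv\<^bsub>monoid_vec TYPE('a) (dim_row A)\<^esub> x = A *\<^sub>v (- z)"
      using z mult_mat_vec_carrier[OF A] by (intro V.inv_equality) (simp_all add: monoid_vec_simps)
    then show "inv\<^bsub>monoid_vec TYPE('a) (dim_row A)\<^esub> x \<in> mat_range A"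
      using z(1) by (simp add: mat_range_def)
  next
    fix x y assume "x \<in> mat_range A" "y \<in> mat_range A"
    then obtain z w where "z \<in> carrier_vec ?n" "w \<in> carrier_vec ?n" "x = A *\<^sub>v z" "y = A *\<^sub>v w"
      by (auto simp: mat_range_def)
    then show "x \<otimes>\<^bsub>monoid_vec TYPE('a) (dim_row A)\<^esub> y \<in> mat_range A"
      by (auto simp: monoid_vec_simps mat_range_def mult_add_distrib_mat_vec[OF A]
          intro!: image_eqI[of _ _ "z + w"])
  qed
qed

lemma normal_mat_range:
  "mat_range A \<lhd> monoid_vec TYPE('a :: comm_ring_1) (dim_row A)"
  using comm_group.subgroup_imp_normal[OF comm_group_vec subgroup_mat_range] .

lemma eq_add_iff_diff_eq_vec:
  fixes x y z :: "'a :: ab_group_add vec"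
  assumes "x \<in> carrier_vec n" "y \<in> carrier_vec n" "z \<in> carrier_vec n"
  shows "x = y + z \<longleftrightarrow> x - y = z"
  using assms by (auto simp: vec_eq_iff algebra_simps)

lemma mem_mat_range_coset_iff:
  fixes A :: "'a :: comm_ring_1 mat"
  assumes "A \<in> carrier_mat n m" "x \<in> carrier_vec n" "t \<in> carrier_vec n"
  shows "x \<in> mat_range A #>\<^bsub>monoid_vec TYPE('a) n\<^esub> t \<longleftrightarrow> x - t \<in> mat_range A"
proof -
  have "x = A *\<^sub>v z + t \<longleftrightarrow> x - t = A *\<^sub>v z" if "z \<in> carrier_vec m" for z
    using eq_add_iff_diff_eq_vec[of x n t "A *\<^sub>v z"] assms comm_add_vec[of "A *\<^sub>v z" n t]
      mult_mat_vec_carrier[OF assms(1) that] by simp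
  then show ?thesis
    using assms(1) by (auto simp: r_coset_def mat_range_def monoid_vec_simps)
qed

lemma right_transversal_mat_range_iff:
  assumes A: "A \<in> carrier_mat n m"
  shows "right_transversal (monoid_vec TYPE('a :: comm_ring_1) n) (mat_range A) T \<longleftrightarrow>
    T \<subseteq> carrier_vec n \<and> (\<forall>x\<in>carrier_vec n. \<exists>!t. t \<in> T \<and> x - t \<in> mat_range A)"
proof (cases "T \<subseteq> carrier_vec n")
  case True
  then have "t \<in> T \<and> x \<in> mat_range A #>\<^bsub>monoid_vec TYPE('a) n\<^esub> t \<longleftrightarrow> t \<in> T \<and> x - t \<in> mat_range A"
    if "x \<in> carrier_vec n" for x t
    using mem_mat_range_coset_iff[OF A that] by blast
  with True show ?thesis
    by (simp add: right_transversal_def monoid_vec_simps)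
qed (simp add: right_transversal_def monoid_vec_simps)

lemma mat_range_mult_right_inverse:
  assumes A: "A \<in> carrier_mat m n" and E: "E \<in> carrier_mat n n" and F: "F \<in> carrier_mat n n"
    and EF: "E * F = 1\<^sub>m n"
  shows "mat_range (A * E) = mat_range A"
proof (intro equalityI subsetI)
  fix y assume "y \<in> mat_range (A * E)"
  then obtain z where "z \<in> carrier_vec n" "y = A *\<^sub>v (E *\<^sub>v z)"
    using A E by (auto simp: mat_range_def)
  then show "y \<in> mat_range A"
    using A E by (auto simp: mat_range_def)
next
  fix y assume "y \<in> mat_range A"
  then obtain z where z: "z \<in> carrier_vec n" "y = A *\<^sub>v z"
    using A by (auto simp: mat_range_def)
  have "A * E * F = A"
    using A E F EF by simp
  then have "y = (A * E) *\<^sub>v (F *\<^sub>v z)"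
    using A E F z by (metis assoc_mult_mat_vec mult_carrier_mat)
  then show "y \<in> mat_range (A * E)"
    using E F z(1) by (auto simp: mat_range_def)
qed

lemma abs_det_mult_right_inverse:
  fixes A :: "int mat"
  assumes "A \<in> carrier_mat n n" and E: "E \<in> carrier_mat n n" and F: "F \<in> carrier_mat n n"
    and EF: "E * F = 1\<^sub>m n"
  shows "\<bar>det (A * E)\<bar> = \<bar>det A\<bar>"
proof -
  have "det E * det F = 1"
    using det_mult[OF E F] EF by simp
  then have "\<bar>det E\<bar> = 1"
    by (simp add: zmult_eq_1_iff) linarith
  then show ?thesis
    using assms by (simp add: det_mult abs_mult)
qed

lemma abs_diff_sgn_mult_less:
  fixes x y :: "'a :: linordered_idom"
  assumes "x \<noteq> 0" "\<bar>x\<bar> \<le> \<bar>y\<bar>"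
  shows "\<bar>y - sgn x * sgn y * x\<bar> < \<bar>y\<bar>"
  using assms by (auto simp: sgn_if abs_if split: if_splits)

lemma exists_mat_range_eq_first_row_less:
  fixes A :: "int mat"
  assumes A: "A \<in> carrier_mat (Suc n) (Suc n)"
    and j: "j < Suc n" "j' < Suc n" "j \<noteq> j'" "A $$ (0, j) \<noteq> 0" "\<bar>A $$ (0, j)\<bar> \<le> \<bar>A $$ (0, j')\<bar>"
  shows "\<exists>B\<in>carrier_mat (Suc n) (Suc n). mat_range B = mat_range A \<and> \<bar>det B\<bar> = \<bar>det A\<bar> \<and>
    (\<Sum>i<Suc n. nat \<bar>B $$ (0, i)\<bar>) < (\<Sum>i<Suc n. nat \<bar>A $$ (0, i)\<bar>)"
proof -
  define a where "a = - (sgn (A $$ (0, j)) * sgn (A $$ (0, j')))"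
  define E where "E = addrow_mat (Suc n) a j j'"
  define F where "F = addrow_mat (Suc n) (- a) j j'"
  have EF: "E \<in> carrier_mat (Suc n) (Suc n)" "F \<in> carrier_mat (Suc n) (Suc n)" "E * F = 1\<^sub>m (Suc n)"
    using addrow_mat_inv[OF j(1-3)] by (simp_all add: E_def F_def)
  have "A * E = addcol a j' j A"
    unfolding E_def using addcol_mat[OF A j(1)] by simp
  moreover have "\<bar>a * A $$ (0, j) + A $$ (0, j')\<bar> < \<bar>A $$ (0, j')\<bar>"
    using abs_diff_sgn_mult_less[OF j(4,5)] by (simp add: a_def)
  ultimately have "(\<Sum>i<Suc n. nat \<bar>(A * E) $$ (0, i)\<bar>) < (\<Sum>i<Suc n. nat \<bar>A $$ (0, i)\<bar>)"
    using A j(1,2)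
    by (intro sum_strict_mono_ex1) (auto intro!: bexI[of _ j'] simp del: index_mult_mat(1))
  moreover have "A * E \<in> carrier_mat (Suc n) (Suc n)"
    using A EF(1) by (rule mult_carrier_mat)
  ultimately show ?thesis
    using mat_range_mult_right_inverse[OF A EF] abs_det_mult_right_inverse[OF A EF]
    by (intro bexI[of _ "A * E"] conjI)
qed

lemma exists_mat_range_eq_swap_first_col:
  fixes A :: "int mat"
  assumes A: "A \<in> carrier_mat (Suc n) (Suc n)" and p: "p < Suc n"
    and row: "\<And>j. j < Suc n \<Longrightarrow> j \<noteq> p \<Longrightarrow> A $$ (0, j) = 0"
  shows "\<exists>B\<in>carrier_mat (Suc n) (Suc n). mat_range B = mat_range A \<and> \<bar>det B\<bar> = \<bar>det A\<bar> \<and>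
    (\<forall>j<n. B $$ (0, Suc j) = 0)"
proof -
  define S :: "int mat" where "S = swaprows_mat (Suc n) 0 p"
  have S: "S \<in> carrier_mat (Suc n) (Suc n)" "S * S = 1\<^sub>m (Suc n)"
    unfolding S_def by (rule swaprows_mat_carrier, rule swaprows_mat_inv[OF zero_less_Suc p])
  have "A * S = swapcols 0 p A"
    unfolding S_def using swapcols_mat[OF A zero_less_Suc p] by (rule sym)
  then have "\<forall>j<n. (A * S) $$ (0, Suc j) = 0"
    using A p row by (auto simp del: index_mult_mat(1))
  moreover have "A * S \<in> carrier_mat (Suc n) (Suc n)"
    using A S(1) by (rule mult_carrier_mat)
  ultimately show ?thesis
    using mat_range_mult_right_inverse[OF A S(1,1,2)] abs_det_mult_right_inverse[OF A S(1,1,2)]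
    by (intro bexI[of _ "A * S"] conjI)
qed

text \<open>The Euclidean algorithm on the entries of the first row.\<close>

lemma exists_mat_range_eq_first_row_zero:
  fixes A :: "int mat"
  assumes "A \<in> carrier_mat (Suc n) (Suc n)"
  shows "\<exists>B\<in>carrier_mat (Suc n) (Suc n). mat_range B = mat_range A \<and> \<bar>det B\<bar> = \<bar>det A\<bar> \<and>
    (\<forall>j<n. B $$ (0, Suc j) = 0)"
  using assms
proof (induction "\<Sum>j<Suc n. nat \<bar>A $$ (0, j)\<bar>" arbitrary: A rule: less_induct)
  case (less A)
  consider (reducible) j j' where "j < Suc n" "j' < Suc n" "j \<noteq> j'" "A $$ (0, j) \<noteq> 0"
      "\<bar>A $$ (0, j)\<bar> \<le> \<bar>A $$ (0, j')\<bar>"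
    | (pivot) p where "p < Suc n" "\<And>j. j < Suc n \<Longrightarrow> j \<noteq> p \<Longrightarrow> A $$ (0, j) = 0"
    by (metis linear zero_less_Suc)
  then show ?case
  proof cases
    case reducible
    obtain B where "B \<in> carrier_mat (Suc n) (Suc n)" "mat_range B = mat_range A" "\<bar>det B\<bar> = \<bar>det A\<bar>"
        "(\<Sum>i<Suc n. nat \<bar>B $$ (0, i)\<bar>) < (\<Sum>i<Suc n. nat \<bar>A $$ (0, i)\<bar>)"
      using exists_mat_range_eq_first_row_less[OF less.prems reducible] by blast
    then show ?thesis
      using less.hyps[of B] by simp
  next
    case pivot
    then show ?thesis
      by (rule exists_mat_range_eq_swap_first_col[OF less.prems])
  qed
qed

lemma det_first_row_zero:
  fixes A :: "'a :: comm_ring_1 mat"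
  assumes A: "A \<in> carrier_mat (Suc n) (Suc n)" and row: "\<And>j. j < n \<Longrightarrow> A $$ (0, Suc j) = 0"
  shows "det A = A $$ (0, 0) * det (mat_delete A 0 0)"
proof -
  have "det A = (\<Sum>j<Suc n. A $$ (0, j) * cofactor A 0 j)"
    using laplace_expansion_row[OF A] by simp
  then show ?thesis
    unfolding sum.lessThan_Suc_shift by (simp add: row cofactor_def)
qed

lemma mult_mat_vec_vCons:
  fixes A :: "'a :: comm_ring_1 mat"
  assumes A: "A \<in> carrier_mat (Suc n) (Suc n)" and row: "\<And>j. j < n \<Longrightarrow> A $$ (0, Suc j) = 0"
    and z: "z \<in> carrier_vec n"
  shows "A *\<^sub>v vCons y z =
    vCons (A $$ (0, 0) * y) (y \<cdot>\<^sub>v vec n (\<lambda>i. A $$ (Suc i, 0)) + mat_delete A 0 0 *\<^sub>v z)"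
    (is "_ = ?r")
proof (rule eq_vecI)
  fix i assume "i < dim_vec ?r"
  then have "i < Suc n"
    using A z mat_delete_carrier[OF A] by simp
  then have "(A *\<^sub>v vCons y z) $ i = A $$ (i, 0) * y + (\<Sum>j = 0..<n. A $$ (i, Suc j) * z $ j)"
    using A z by (simp add: scalar_prod_def sum.atLeast0_lessThan_Suc_shift del: sum.op_ivl_Suc)
  also have "\<dots> = ?r $ i"
    using A z \<open>i < Suc n\<close> row mat_delete_carrier[OF A]
    by (cases i) (simp_all add: scalar_prod_def mat_delete_def mult.commute)
  finally show "(A *\<^sub>v vCons y z) $ i = ?r $ i" .
qed (use A z mat_delete_carrier[OF A] in simp)

lemma vCons_mem_mat_range_iff:
  fixes A :: "'a :: idom_divide mat"
  assumes A: "A \<in> carrier_mat (Suc n) (Suc n)" and row: "\<And>j. j < n \<Longrightarrow> A $$ (0, Suc j) = 0"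
    and d: "A $$ (0, 0) \<noteq> 0" and x: "x \<in> carrier_vec n"
  shows "vCons a x \<in> mat_range A \<longleftrightarrow> A $$ (0, 0) dvd a \<and>
    x - (a div A $$ (0, 0)) \<cdot>\<^sub>v vec n (\<lambda>i. A $$ (Suc i, 0)) \<in> mat_range (mat_delete A 0 0)"
proof -
  let ?d = "A $$ (0, 0)" and ?c = "vec n (\<lambda>i. A $$ (Suc i, 0))" and ?M = "mat_delete A 0 0"
  have M: "?M \<in> carrier_mat n n"
    using mat_delete_carrier[OF A] by simp
  have "vCons a x \<in> mat_range A \<longleftrightarrow> (\<exists>y. \<exists>z\<in>carrier_vec n. vCons a x = A *\<^sub>v vCons y z)"
  proof
    assume "vCons a x \<in> mat_range A"
    then obtain w where "w \<in> carrier_vec (Suc n)" "vCons a x = A *\<^sub>v w"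
      using A by (auto simp: mat_range_def)
    then show "\<exists>y. \<exists>z\<in>carrier_vec n. vCons a x = A *\<^sub>v vCons y z"
      by (cases w) auto
  qed (use A in \<open>auto simp: mat_range_def\<close>)
  also have "\<dots> \<longleftrightarrow> (\<exists>y. \<exists>z\<in>carrier_vec n. a = ?d * y \<and> x = y \<cdot>\<^sub>v ?c + ?M *\<^sub>v z)"
    using A row by (simp add: mult_mat_vec_vCons)
  also have "\<dots> \<longleftrightarrow> (\<exists>y. \<exists>z\<in>carrier_vec n. a = ?d * y \<and> x - y \<cdot>\<^sub>v ?c = ?M *\<^sub>v z)"
    using x M by (simp add: eq_add_iff_diff_eq_vec[of x n])
  also have "\<dots> \<longleftrightarrow> ?d dvd a \<and> x - (a div ?d) \<cdot>\<^sub>v ?c \<in> mat_range ?M"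
  proof -
    have "a = ?d * y \<longleftrightarrow> ?d dvd a \<and> y = a div ?d" for y
      using d by auto
    then show ?thesis
      using carrier_matD(2)[OF M] by (auto simp: mat_range_def simp del: mat_delete_dim)
  qed
  finally show ?thesis .
qed

lemma dvd_diff_abs_range_iff:
  fixes a d x :: int
  assumes "d \<noteq> 0"
  shows "a \<in> {0..<\<bar>d\<bar>} \<and> d dvd x - a \<longleftrightarrow> a = x mod \<bar>d\<bar>"
proof -
  have "d dvd x - a \<longleftrightarrow> x mod \<bar>d\<bar> = a mod \<bar>d\<bar>"
    by (simp add: mod_eq_dvd_iff)
  then show ?thesis
    using assms by auto
qed

lemma vCons_diff_mem_mat_range_iff:
  fixes A :: "int mat"
  assumes A: "A \<in> carrier_mat (Suc n) (Suc n)" and row: "\<And>j. j < n \<Longrightarrow> A $$ (0, Suc j) = 0"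
    and d: "A $$ (0, 0) \<noteq> 0" and x: "x \<in> carrier_vec n" and t: "t \<in> carrier_vec n"
  shows "a \<in> {0..<\<bar>A $$ (0, 0)\<bar>} \<and> vCons b x - vCons a t \<in> mat_range A \<longleftrightarrow>
    a = b mod \<bar>A $$ (0, 0)\<bar> \<and>
    x - ((b - b mod \<bar>A $$ (0, 0)\<bar>) div A $$ (0, 0)) \<cdot>\<^sub>v vec n (\<lambda>i. A $$ (Suc i, 0)) - t
      \<in> mat_range (mat_delete A 0 0)"
proof -
  let ?d = "A $$ (0, 0)" and ?c = "vec n (\<lambda>i. A $$ (Suc i, 0))"
  have "vCons b x - vCons a t = vCons (b - a) (x - t)"
    using x t by (intro eq_vecI) (auto simp: vec_index_vCons)
  moreover have "x - t - e \<cdot>\<^sub>v ?c = x - e \<cdot>\<^sub>v ?c - t" for e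
    using x t by (intro eq_vecI) auto
  ultimately have "vCons b x - vCons a t \<in> mat_range A \<longleftrightarrow>
      ?d dvd b - a \<and> x - ((b - a) div ?d) \<cdot>\<^sub>v ?c - t \<in> mat_range (mat_delete A 0 0)"
    using vCons_mem_mat_range_iff[OF A row d, of "x - t" "b - a"] x t
    by (simp only: minus_carrier_vec)
  then show ?thesis
    using dvd_diff_abs_range_iff[OF d, of a b] by blast
qed

lemma ex1_vCons_diff_mem_mat_range:
  fixes A :: "int mat"
  assumes A: "A \<in> carrier_mat (Suc n) (Suc n)" and row: "\<And>j. j < n \<Longrightarrow> A $$ (0, Suc j) = 0"
    and d: "A $$ (0, 0) \<noteq> 0" and T: "T \<subseteq> carrier_vec n"
    and unique: "\<And>x. x \<in> carrier_vec n \<Longrightarrow> \<exists>!t. t \<in> T \<and> x - t \<in> mat_range (mat_delete A 0 0)"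
    and x: "x \<in> carrier_vec n"
  shows "\<exists>!s. s \<in> (\<lambda>(a, t). vCons a t) ` ({0..<\<bar>A $$ (0, 0)\<bar>} \<times> T) \<and> vCons b x - s \<in> mat_range A"
proof -
  let ?d = "A $$ (0, 0)" and ?M = "mat_delete A 0 0"
  let ?r = "b mod \<bar>?d\<bar>"
  let ?y = "x - ((b - ?r) div ?d) \<cdot>\<^sub>v vec n (\<lambda>i. A $$ (Suc i, 0))"
  have mem_iff: "a \<in> {0..<\<bar>?d\<bar>} \<and> vCons b x - vCons a t \<in> mat_range A \<longleftrightarrow>
      a = ?r \<and> ?y - t \<in> mat_range ?M" if "t \<in> T" for a t
    using T that by (intro vCons_diff_mem_mat_range_iff[OF A row d x]) auto
  have "?y \<in> carrier_vec n"
    using x by simp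
  then obtain t where t: "t \<in> T" "?y - t \<in> mat_range ?M"
    and t_unique: "\<And>s. s \<in> T \<Longrightarrow> ?y - s \<in> mat_range ?M \<Longrightarrow> s = t"
    using unique by blast
  show ?thesis
  proof (rule ex1I[of _ "vCons ?r t"])
    show "vCons ?r t \<in> (\<lambda>(a, t). vCons a t) ` ({0..<\<bar>?d\<bar>} \<times> T) \<and>
        vCons b x - vCons ?r t \<in> mat_range A"
      using mem_iff[OF t(1)] t by blast
    fix s assume "s \<in> (\<lambda>(a, t). vCons a t) ` ({0..<\<bar>?d\<bar>} \<times> T) \<and> vCons b x - s \<in> mat_range A"
    then obtain a s' where s: "s = vCons a s'" "s' \<in> T"
        "a \<in> {0..<\<bar>?d\<bar>} \<and> vCons b x - vCons a s' \<in> mat_range A"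
      by fast
    then have "a = ?r" "s' = t"
      using mem_iff[OF s(2)] t_unique[OF s(2)] by blast+
    then show "s = vCons ?r t"
      using s(1) by simp
  qed
qed

lemma right_transversal_first_row_zero:
  fixes A :: "int mat"
  assumes A: "A \<in> carrier_mat (Suc n) (Suc n)" and row: "\<And>j. j < n \<Longrightarrow> A $$ (0, Suc j) = 0"
    and d: "A $$ (0, 0) \<noteq> 0"
    and T: "right_transversal (monoid_vec TYPE(int) n) (mat_range (mat_delete A 0 0)) T"
  shows "right_transversal (monoid_vec TYPE(int) (Suc n)) (mat_range A)
    ((\<lambda>(a, t). vCons a t) ` ({0..<\<bar>A $$ (0, 0)\<bar>} \<times> T))" (is "right_transversal _ _ ?T")
proof -
  have M: "mat_delete A 0 0 \<in> carrier_mat n n"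
    using mat_delete_carrier[OF A] by simp
  have Tn: "T \<subseteq> carrier_vec n"
    and unique: "\<And>x. x \<in> carrier_vec n \<Longrightarrow> \<exists>!t. t \<in> T \<and> x - t \<in> mat_range (mat_delete A 0 0)"
    using T by (auto simp: right_transversal_mat_range_iff[OF M])
  have "?T \<subseteq> carrier_vec (Suc n)"
    using Tn by auto
  moreover have "\<forall>w\<in>carrier_vec (Suc n). \<exists>!s. s \<in> ?T \<and> w - s \<in> mat_range A"
  proof
    fix w :: "int vec" assume "w \<in> carrier_vec (Suc n)"
    then obtain b x where w: "w = vCons b x" and x: "x \<in> carrier_vec n"
      by (cases w) auto
    show "\<exists>!s. s \<in> ?T \<and> w - s \<in> mat_range A"
      unfolding w by (rule ex1_vCons_diff_mem_mat_range[OF A row d Tn unique x])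
  qed
  ultimately show ?thesis
    unfolding right_transversal_mat_range_iff[OF A] by (rule conjI)
qed

lemma exists_right_transversal_mat_range:
  fixes A :: "int mat"
  assumes "A \<in> carrier_mat n n" "det A \<noteq> 0"
  shows "\<exists>T. right_transversal (monoid_vec TYPE(int) n) (mat_range A) T \<and>
    finite T \<and> int (card T) = \<bar>det A\<bar>"
  using assms
proof (induction n arbitrary: A)
  case 0
  have "x - 0\<^sub>v 0 = A *\<^sub>v 0\<^sub>v 0" if "x \<in> carrier_vec 0" for x
    using 0(1) that by (intro eq_vecI) simp_all
  then have "right_transversal (monoid_vec TYPE(int) 0) (mat_range A) {0\<^sub>v 0}"
    using 0(1) unfolding right_transversal_mat_range_iff[OF 0(1)] by (auto simp: mat_range_def)
  then show ?case
    using 0(1) by (intro exI[of _ "{0\<^sub>v 0}"]) simp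
next
  case (Suc n)
  obtain B where B: "B \<in> carrier_mat (Suc n) (Suc n)" "mat_range B = mat_range A"
      "\<bar>det B\<bar> = \<bar>det A\<bar>" and row: "\<And>j. j < n \<Longrightarrow> B $$ (0, Suc j) = 0"
    using exists_mat_range_eq_first_row_zero[OF Suc.prems(1)] by blast
  have det_B: "det B = B $$ (0, 0) * det (mat_delete B 0 0)"
    using B(1) row by (rule det_first_row_zero)
  then have nonzero: "B $$ (0, 0) \<noteq> 0" "det (mat_delete B 0 0) \<noteq> 0"
    using B(3) Suc.prems(2) by auto
  obtain T where T: "right_transversal (monoid_vec TYPE(int) n) (mat_range (mat_delete B 0 0)) T"
      "finite T" "int (card T) = \<bar>det (mat_delete B 0 0)\<bar>"
    using Suc.IH[of "mat_delete B 0 0"] nonzero(2) mat_delete_carrier[OF B(1)] by auto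
  let ?T = "(\<lambda>(a, t). vCons a t) ` ({0..<\<bar>B $$ (0, 0)\<bar>} \<times> T)"
  have "right_transversal (monoid_vec TYPE(int) (Suc n)) (mat_range A) ?T"
    using right_transversal_first_row_zero[OF B(1) row nonzero(1) T(1)] B(2) by simp
  moreover have "int (card ?T) = \<bar>det A\<bar>"
  proof -
    have "card ?T = card ({0..<\<bar>B $$ (0, 0)\<bar>} \<times> T)"
      by (rule card_image) (auto simp: inj_on_def)
    then show ?thesis
      using T(3) unfolding B(3)[symmetric] det_B by (simp add: card_cartesian_product abs_mult)
  qed
  ultimately show ?case
    using T(2) by blast
qed

lemma card_mat_cokernel:
  fixes A :: "int mat"
  assumes A: "A \<in> carrier_mat n n" and "det A \<noteq> 0"
  shows "finite (carrier (mat_cokernel A))" "int (card (carrier (mat_cokernel A))) = \<bar>det A\<bar>"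
proof -
  interpret V: comm_group "monoid_vec TYPE(int) n"
    by (rule comm_group_vec)
  obtain T where T: "right_transversal (monoid_vec TYPE(int) n) (mat_range A) T"
      "finite T" "int (card T) = \<bar>det A\<bar>"
    using exists_right_transversal_mat_range[OF assms] by blast
  have "bij_betw (\<lambda>t. mat_range A #>\<^bsub>monoid_vec TYPE(int) n\<^esub> t) T (carrier (mat_cokernel A))"
    using V.bij_betw_right_transversal[OF _ T(1)] subgroup_mat_range[of A] A
    by (simp add: mat_cokernel_def FactGroup_def)
  then show "finite (carrier (mat_cokernel A))" "int (card (carrier (mat_cokernel A))) = \<bar>det A\<bar>"
    using T(2,3) by (simp_all add: bij_betw_finite bij_betw_same_card[symmetric])
qed

section \<open>Matrices indexed by lists\<close>

definition list_vec :: "'a list \<Rightarrow> ('a \<Rightarrow> 'b) \<Rightarrow> 'b vec" where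
  "list_vec xs g = vec (length xs) (\<lambda>i. g (xs ! i))"

definition list_mat :: "'a list \<Rightarrow> ('a \<Rightarrow> 'a \<Rightarrow> 'b) \<Rightarrow> 'b mat" where
  "list_mat xs f = mat (length xs) (length xs) (\<lambda>(i, j). f (xs ! i) (xs ! j))"

lemma list_vec_carrier [simp]: "list_vec xs g \<in> carrier_vec (length xs)"
  by (simp add: list_vec_def)

lemma list_mat_carrier [simp]: "list_mat xs f \<in> carrier_mat (length xs) (length xs)"
  by (simp add: list_mat_def)

lemma list_vec_index [simp]:
  "i < length xs \<Longrightarrow> list_vec xs g $ i = g (xs ! i)"
  "dim_vec (list_vec xs g) = length xs"
  by (simp_all add: list_vec_def)

lemma list_mat_index [simp]:
  "i < length xs \<Longrightarrow> j < length xs \<Longrightarrow> list_mat xs f $$ (i, j) = f (xs ! i) (xs ! j)"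
  "dim_row (list_mat xs f) = length xs" "dim_col (list_mat xs f) = length xs"
  by (simp_all add: list_mat_def)

lemma list_vec_eq_iff: "list_vec xs f = list_vec xs g \<longleftrightarrow> (\<forall>x\<in>set xs. f x = g x)"
  by (auto simp: vec_eq_iff all_set_conv_all_nth)

lemma list_mat_eq_iff: "list_mat xs f = list_mat xs g \<longleftrightarrow> (\<forall>x\<in>set xs. \<forall>y\<in>set xs. f x y = g x y)"
  by (auto simp: mat_eq_iff all_set_conv_all_nth)

lemma list_vec_add: "list_vec xs (\<lambda>x. f x + g x) = list_vec xs f + list_vec xs g"
  by (rule eq_vecI) simp_all

lemma list_mat_map: "list_mat (map h xs) f = list_mat xs (\<lambda>x y. f (h x) (h y))"
  by (rule eq_matI) simp_all

lemma exists_list_vec: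
  assumes "distinct xs" "w \<in> carrier_vec (length xs)"
  shows "\<exists>g. w = list_vec xs g"
proof -
  have "inj_on ((!) xs) {..<length xs}"
    using assms(1) by (simp add: inj_on_nth)
  then have "w = list_vec xs (\<lambda>x. w $ inv_into {..<length xs} ((!) xs) x)"
    using assms(2) by (intro eq_vecI) simp_all
  then show ?thesis
    by blast
qed

lemma sum_set_conv_nth:
  assumes "distinct xs"
  shows "(\<Sum>x\<in>set xs. g x) = (\<Sum>i = 0..<length xs. g (xs ! i))"
  using assms by (simp add: sum.distinct_set_conv_list sum_list_sum_nth)

lemma list_mat_mult_list_vec:
  fixes f :: "'a \<Rightarrow> 'a \<Rightarrow> 'b :: comm_semiring_0"
  assumes "distinct xs"
  shows "list_mat xs f *\<^sub>v list_vec xs g = list_vec xs (\<lambda>x. \<Sum>y\<in>set xs. f x y * g y)"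
  by (rule eq_vecI) (simp_all add: scalar_prod_def sum_set_conv_nth[OF assms])

lemma list_mat_mult_list_mat:
  fixes f :: "'a \<Rightarrow> 'a \<Rightarrow> 'b :: comm_semiring_0"
  assumes "distinct xs"
  shows "list_mat xs f * list_mat xs g = list_mat xs (\<lambda>x y. \<Sum>z\<in>set xs. f x z * g z y)"
  by (rule eq_matI) (simp_all add: scalar_prod_def sum_set_conv_nth[OF assms])

lemma list_mat_eq_one:
  assumes "distinct xs" "\<And>x y. x \<in> set xs \<Longrightarrow> y \<in> set xs \<Longrightarrow> f x y = (if x = y then 1 else 0)"
  shows "list_mat xs f = 1\<^sub>m (length xs)"
  using assms by (intro eq_matI) (simp_all add: nth_eq_iff_index_eq)

lemma det_list_mat_eq_0_iff:
  fixes f :: "'a \<Rightarrow> 'a \<Rightarrow> 'b :: idom"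
  assumes "distinct xs"
  shows "det (list_mat xs f) = 0 \<longleftrightarrow>
    (\<exists>g. (\<exists>x\<in>set xs. g x \<noteq> 0) \<and> (\<forall>x\<in>set xs. (\<Sum>y\<in>set xs. f x y * g y) = 0))"
proof -
  have zero: "0\<^sub>v (length xs) = list_vec xs (\<lambda>_. 0)"
    by (rule eq_vecI) simp_all
  have "det (list_mat xs f) = 0 \<longleftrightarrow>
      (\<exists>g. list_vec xs g \<noteq> 0\<^sub>v (length xs) \<and> list_mat xs f *\<^sub>v list_vec xs g = 0\<^sub>v (length xs))"
    using det_0_iff_vec_prod_zero[OF list_mat_carrier, of xs f] exists_list_vec[OF assms]
    by (metis list_vec_carrier)
  then show ?thesis
    by (simp add: list_mat_mult_list_vec[OF assms] zero list_vec_eq_iff)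
qed

lemma of_int_det_list_mat:
  "of_int (det (list_mat xs f)) = det (list_mat xs (\<lambda>x y. of_int (f x y) :: 'b :: comm_ring_1))"
proof -
  have "map_mat of_int (list_mat xs f) = list_mat xs (\<lambda>x y. of_int (f x y) :: 'b)"
    by (rule eq_matI) simp_all
  then show ?thesis
    by (metis of_int_hom.hom_det)
qed

lemma det_list_mat_transpose:
  fixes f :: "'a \<Rightarrow> 'a \<Rightarrow> 'b :: comm_ring_1"
  shows "det (list_mat xs (\<lambda>x y. f y x)) = det (list_mat xs f)"
proof -
  have "list_mat xs (\<lambda>x y. f y x) = transpose_mat (list_mat xs f)"
    by (rule eq_matI) simp_all
  then show ?thesis
    by (simp add: det_transpose[OF list_mat_carrier])
qed

lemma det_list_mat_append:
  fixes f :: "'a \<Rightarrow> 'a \<Rightarrow> 'b :: idom"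
  assumes "\<And>x y. x \<in> set xs \<Longrightarrow> y \<in> set ys \<Longrightarrow> f x y = 0"
  shows "det (list_mat (xs @ ys) f) = det (list_mat xs f) * det (list_mat ys f)"
proof -
  let ?C = "mat (length ys) (length xs) (\<lambda>(i, j). f (ys ! i) (xs ! j))"
  have "list_mat (xs @ ys) f =
      four_block_mat (list_mat xs f) (0\<^sub>m (length xs) (length ys)) ?C (list_mat ys f)"
    by (rule eq_matI) (auto simp: nth_append assms)
  then show ?thesis
    by (simp add: det_four_block_mat_upper_right_zero[of _ "length xs" _ "length ys"])
qed

definition list_Sigma :: "'i list \<Rightarrow> ('i \<Rightarrow> 'a list) \<Rightarrow> ('i \<times> 'a) list" where
  "list_Sigma is xs = concat (map (\<lambda>i. map (Pair i) (xs i)) is)"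

lemma list_Sigma_simps [simp]:
  "list_Sigma [] xs = []"
  "list_Sigma (i # is) xs = map (Pair i) (xs i) @ list_Sigma is xs"
  by (simp_all add: list_Sigma_def)

lemma set_list_Sigma [simp]: "set (list_Sigma is xs) = (SIGMA i:set is. set (xs i))"
  by (auto simp: list_Sigma_def)

lemma distinct_list_Sigma:
  "distinct is \<Longrightarrow> (\<And>i. i \<in> set is \<Longrightarrow> distinct (xs i)) \<Longrightarrow> distinct (list_Sigma is xs)"
  by (induction "is") (auto simp: distinct_map inj_on_def)

lemma det_list_mat_list_Sigma:
  fixes f :: "'i \<times> 'a \<Rightarrow> 'i \<times> 'a \<Rightarrow> 'b :: idom"
  assumes "distinct is"
    and "\<And>i j x y. i \<in> set is \<Longrightarrow> j \<in> set is \<Longrightarrow> i \<noteq> j \<Longrightarrow> x \<in> set (xs i) \<Longrightarrow> y \<in> set (xs j) \<Longrightarrow>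
      f (i, x) (j, y) = 0"
  shows "det (list_mat (list_Sigma is xs) f) =
    (\<Prod>i\<in>set is. det (list_mat (xs i) (\<lambda>x y. f (i, x) (i, y))))"
  using assms
proof (induction "is")
  case Nil
  then show ?case
    by (simp add: list_mat_def)
next
  case (Cons i "is")
  have "det (list_mat (list_Sigma (i # is) xs) f) =
      det (list_mat (map (Pair i) (xs i)) f) * det (list_mat (list_Sigma is xs) f)"
    unfolding list_Sigma_simps using Cons.prems by (intro det_list_mat_append) auto
  also have "det (list_mat (list_Sigma is xs) f) =
      (\<Prod>i\<in>set is. det (list_mat (xs i) (\<lambda>x y. f (i, x) (i, y))))"
    using Cons.prems by (intro Cons.IH) auto
  finally show ?case
    using Cons.prems(1) by (simp add: list_mat_map)
qed

lemma det_list_mat_Cons_row_zero: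
  fixes f :: "'a \<Rightarrow> 'a \<Rightarrow> 'b :: idom"
  assumes "\<And>y. y \<in> set xs \<Longrightarrow> f v y = 0"
  shows "det (list_mat (v # xs) f) = f v v * det (list_mat xs f)"
proof -
  have "det (list_mat ([v] @ xs) f) = det (list_mat [v] f) * det (list_mat xs f)"
    by (rule det_list_mat_append) (simp add: assms)
  moreover have "det (list_mat [v] f) = f v v"
    by (simp add: list_mat_def det_single)
  ultimately show ?thesis
    by simp
qed

lemma det_list_mat_Cons_col_zero:
  fixes f :: "'a \<Rightarrow> 'a \<Rightarrow> 'b :: idom"
  assumes "\<And>x. x \<in> set xs \<Longrightarrow> f x v = 0"
  shows "det (list_mat (v # xs) f) = f v v * det (list_mat xs f)"
  using det_list_mat_Cons_row_zero[of xs "\<lambda>x y. f y x" v] assms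
    det_list_mat_transpose[of "v # xs" f] det_list_mat_transpose[of xs f] by simp

lemma det_list_mat_add_rows_to_first:
  fixes f :: "'a \<Rightarrow> 'a \<Rightarrow> 'b :: idom"
  assumes "distinct (v # xs)"
  shows "det (list_mat (v # xs) (\<lambda>x y. if x = v then \<Sum>z\<in>set (v # xs). f z y else f x y)) =
    det (list_mat (v # xs) f)"
proof -
  define p where "p x y = (if x = v \<or> x = y then 1 else 0 :: 'b)" for x y
  have "(\<Sum>z\<in>set (v # xs). p x z * f z y) = (if x = v then \<Sum>z\<in>set (v # xs). f z y else f x y)"
    if "x \<in> set (v # xs)" for x y
  proof (cases "x = v")
    case False
    then have "(\<Sum>z\<in>set (v # xs). p x z * f z y) = (\<Sum>z\<in>set (v # xs). if x = z then f z y else 0)"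
      by (intro sum.cong) (auto simp: p_def)
    then show ?thesis
      using False that by simp
  qed (simp add: p_def)
  then have "list_mat (v # xs) (\<lambda>x y. if x = v then \<Sum>z\<in>set (v # xs). f z y else f x y) =
      list_mat (v # xs) p * list_mat (v # xs) f"
    by (simp only: list_mat_mult_list_mat[OF assms] list_mat_eq_iff) simp
  moreover have "det (list_mat (v # xs) p) = 1"
  proof -
    have "list_mat xs p = 1\<^sub>m (length xs)"
      using assms by (intro list_mat_eq_one) (auto simp: p_def)
    then show ?thesis
      using assms by (subst det_list_mat_Cons_col_zero) (auto simp: p_def)
  qed
  ultimately show ?thesis
    by (simp add: det_mult[OF list_mat_carrier list_mat_carrier])
qed

lemma det_list_mat_diff_first_col:
  fixes f :: "'a \<Rightarrow> 'a \<Rightarrow> 'b :: idom"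
  assumes "distinct (v # xs)"
  shows "det (list_mat (v # xs) (\<lambda>x y. if y = v then f x v else f x y - f x v)) =
    det (list_mat (v # xs) f)"
proof -
  define q where "q x y = (if x = y then 1 else 0) - (if x = v \<and> y \<noteq> v then 1 else 0 :: 'b)" for x y
  have "(\<Sum>z\<in>set (v # xs). f x z * q z y) = (if y = v then f x v else f x y - f x v)"
    if "y \<in> set (v # xs)" for x y
  proof -
    have "f x z * q z y =
        (if z = y then f x z else 0) - (if z = v then if y = v then 0 else f x z else 0)" for z
      by (simp add: q_def)
    then show ?thesis
      using that by (simp only: sum_subtractf) simp
  qed
  then have "list_mat (v # xs) (\<lambda>x y. if y = v then f x v else f x y - f x v) =
      list_mat (v # xs) f * list_mat (v # xs) q"
    by (simp only: list_mat_mult_list_mat[OF assms] list_mat_eq_iff) simp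
  moreover have "det (list_mat (v # xs) q) = 1"
  proof -
    have "list_mat xs q = 1\<^sub>m (length xs)"
      using assms by (intro list_mat_eq_one) (auto simp: q_def)
    then show ?thesis
      using assms by (subst det_list_mat_Cons_col_zero) (auto simp: q_def)
  qed
  ultimately show ?thesis
    by (simp add: det_mult[OF list_mat_carrier list_mat_carrier])
qed

lemma det_list_mat_const_col_sum:
  fixes f :: "'a \<Rightarrow> 'a \<Rightarrow> 'b :: idom"
  assumes dist: "distinct (v # xs)"
    and col_sum: "\<And>y. y \<in> set (v # xs) \<Longrightarrow> (\<Sum>x\<in>set (v # xs). f x y) = s"
  shows "det (list_mat (v # xs) f) = s * det (list_mat xs (\<lambda>x y. f x y - f x v))"
proof -
  define r where "r x y = (if x = v then s else f x y)" for x y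
  define h where "h x y = (if y = v then r x v else r x y - r x v)" for x y
  have v: "v \<notin> set xs"
    using dist by simp
  have "det (list_mat (v # xs) f) = det (list_mat (v # xs) r)"
    unfolding r_def det_list_mat_add_rows_to_first[OF dist, of f, symmetric]
    by (intro arg_cong[of _ _ det] list_mat_eq_iff[THEN iffD2] ballI) (simp only: col_sum)
  also have "\<dots> = det (list_mat (v # xs) h)"
    unfolding h_def using det_list_mat_diff_first_col[OF dist] by (rule sym)
  also have "\<dots> = s * det (list_mat xs h)"
    using v by (subst det_list_mat_Cons_row_zero) (auto simp: h_def r_def)
  also have "list_mat xs h = list_mat xs (\<lambda>x y. f x y - f x v)"
    using v by (auto simp: list_mat_eq_iff h_def r_def)
  finally show ?thesis .
qed

lemma det_list_mat_add_row_sum: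
  fixes f :: "'a \<Rightarrow> 'a \<Rightarrow> 'b :: idom"
  assumes "distinct xs"
  shows "det (list_mat xs (\<lambda>x y. f x y + (\<Sum>z\<in>set xs. f x z))) =
    (of_nat (length xs) + 1) * det (list_mat xs f)"
proof -
  let ?g = "\<lambda>x y. (if x = y then 1 else 0) + 1 :: 'b"
  have "det (list_mat xs ?g) = of_nat (length xs) + 1"
  proof (cases xs)
    case Nil
    then show ?thesis
      by (simp add: list_mat_def)
  next
    case (Cons v ys)
    then have dist: "distinct (v # ys)"
      using assms by simp
    have "det (list_mat (v # ys) ?g) =
        (of_nat (length xs) + 1) * det (list_mat ys (\<lambda>x y. ?g x y - ?g x v))"
      using dist by (intro det_list_mat_const_col_sum) (auto simp: sum.distrib distinct_card Cons)
    also have "list_mat ys (\<lambda>x y. ?g x y - ?g x v) = 1\<^sub>m (length ys)"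
      using dist by (intro list_mat_eq_one) auto
    finally show ?thesis
      by (simp add: Cons)
  qed
  moreover have "list_mat xs (\<lambda>x y. f x y + (\<Sum>z\<in>set xs. f x z)) = list_mat xs f * list_mat xs ?g"
    by (simp add: list_mat_mult_list_mat[OF assms] list_mat_eq_iff distrib_left sum.distrib
        if_distrib[of "\<lambda>x. _ * x"] cong: if_cong)
  ultimately show ?thesis
    by (simp add: det_mult[OF list_mat_carrier list_mat_carrier] mult.commute)
qed

section \<open>Matrices of linear maps\<close>

definition (in vector_space) basis_matrix :: "'b list \<Rightarrow> 'b list \<Rightarrow> ('b \<Rightarrow> 'b) \<Rightarrow> 'a mat" where
  "basis_matrix bs cs f =
     mat (length cs) (length bs) (\<lambda>(i, j). representation (set cs) (f (bs ! j)) (cs ! i))"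

lemma (in vector_space) basis_matrix_mult:
  assumes cs: "distinct cs" "independent (set cs)" and ds: "independent (set ds)"
    and f: "f ` set bs \<subseteq> span (set cs)"
    and g: "Vector_Spaces.linear scale scale g" "g ` set cs \<subseteq> span (set ds)"
  shows "basis_matrix cs ds g * basis_matrix bs cs f = basis_matrix bs ds (g \<circ> f)"
proof (rule eq_matI)
  interpret g: Vector_Spaces.linear scale scale g by fact
  let ?R = "\<lambda>bs. representation (set bs)"
  fix i j
  assume "i < dim_row (basis_matrix bs ds (g \<circ> f))" "j < dim_col (basis_matrix bs ds (g \<circ> f))"
  then have ij: "i < length ds" "j < length bs"
    by (simp_all add: basis_matrix_def)
  have "f (bs ! j) = (\<Sum>c\<in>set cs. scale (?R cs (f (bs ! j)) c) c)"
    using f ij(2) by (intro sum_representation_eq[symmetric] cs(2)) auto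
  then have "g (f (bs ! j)) = (\<Sum>c\<in>set cs. scale (?R cs (f (bs ! j)) c) (g c))"
    by (metis (no_types, lifting) g.scale g.sum sum.cong)
  then have "?R ds (g (f (bs ! j))) (ds ! i) =
      (\<Sum>c\<in>set cs. ?R cs (f (bs ! j)) c * ?R ds (g c) (ds ! i))"
    using g(2)
    by (simp add: representation_sum[OF ds] representation_scale[OF ds] span_scale image_subset_iff)
  also have "\<dots> = (basis_matrix cs ds g * basis_matrix bs cs f) $$ (i, j)"
    using ij by (simp add: basis_matrix_def scalar_prod_def sum_set_conv_nth[OF cs(1)] mult.commute)
  finally show "(basis_matrix cs ds g * basis_matrix bs cs f) $$ (i, j) =
      basis_matrix bs ds (g \<circ> f) $$ (i, j)"
    using ij by (simp add: basis_matrix_def)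
qed (simp_all add: basis_matrix_def)

lemma (in vector_space) basis_matrix_id:
  assumes "distinct bs" "independent (set bs)"
  shows "basis_matrix bs bs id = 1\<^sub>m (length bs)"
  using assms by (intro eq_matI)
    (auto simp: basis_matrix_def representation_basis nth_eq_iff_index_eq)

lemma (in vector_space) similar_basis_matrix:
  assumes bs: "distinct bs" "independent (set bs)" and cs: "distinct cs" "independent (set cs)"
    and span: "span (set cs) = span (set bs)"
    and f: "Vector_Spaces.linear scale scale f" "f ` span (set bs) \<subseteq> span (set bs)"
  shows "similar_mat (basis_matrix bs bs f) (basis_matrix cs cs f)"
proof -
  let ?P = "basis_matrix cs bs id" and ?Q = "basis_matrix bs cs id"
  have len: "length cs = length bs"
    using dim_eq_card[OF span cs(2)] dim_eq_card_independent[OF bs(2)] bs(1) cs(1)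
    by (simp add: distinct_card)
  have sub: "set bs \<subseteq> span (set bs)" "set cs \<subseteq> span (set bs)"
    using span_superset[of "set bs"] span_superset[of "set cs"] by (simp_all add: span)
  then have f_sub: "f ` set bs \<subseteq> span (set bs)" "f ` set cs \<subseteq> span (set bs)"
    using f(2) by blast+
  have carrier: "basis_matrix ds es g \<in> carrier_mat (length es) (length ds)" for ds es g
    by (simp add: basis_matrix_def)
  have "?P * ?Q = 1\<^sub>m (length bs)" "?Q * ?P = 1\<^sub>m (length bs)"
    using sub by (simp_all add: basis_matrix_mult bs cs span linear_id basis_matrix_id len)
  moreover have "?P * basis_matrix cs cs f * ?Q = basis_matrix bs bs f"
  proof -
    have "?P * basis_matrix cs cs f * ?Q = ?P * (basis_matrix cs cs f * ?Q)"
      by (rule assoc_mult_mat[OF carrier carrier carrier])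
    also have "\<dots> = basis_matrix bs bs f"
      using sub f(1) f_sub by (simp add: basis_matrix_mult bs cs span linear_id)
    finally show ?thesis .
  qed
  ultimately show ?thesis
    by (intro similar_matI[of _ _ ?P ?Q "length bs"]) (auto simp: basis_matrix_def len)
qed

lemma endo_char_poly_eq:
  assumes bs: "is_ordered_basis bs W"
    and f: "Vector_Spaces.linear rat_scale rat_scale f" "f ` W \<subseteq> W"
  shows "endo_char_poly W f = char_poly (endo_matrix bs f)"
proof -
  define cs where "cs = (SOME bs. is_ordered_basis bs W)"
  have cs: "is_ordered_basis cs W"
    unfolding cs_def using bs by (rule someI)
  have matrix: "endo_matrix ds f = ratvs.basis_matrix ds ds f" for ds
    by (simp add: endo_matrix_def ratvs.basis_matrix_def)
  have "similar_mat (endo_matrix cs f) (endo_matrix bs f)"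
    unfolding matrix using bs cs f
    by (intro ratvs.similar_basis_matrix) (simp_all add: is_ordered_basis_def)
  then show ?thesis
    unfolding endo_char_poly_def cs_def[symmetric] by (rule char_poly_similar)
qed

section \<open>The Laplacian\<close>

lemma connected_imp_pverts_nonempty:
  "Digraph_Component.connected (with_proj G) \<Longrightarrow> pverts G \<noteq> {}"
  by (auto simp: Digraph_Component.connected_def strongly_connected_def)

lemma group_Div0: "group (Div0 G)"
proof -
  interpret D: group "Div G"
    by (simp add: Div_def)
  have "group_hom (Div G) integer_group div_degree"
    using D.group_axioms
    by (auto simp: group_hom_def group_hom_axioms_def hom_def Div_def div_degree_add)
  then have "subgroup (kernel (Div G) integer_group div_degree) (Div G)"
    by (rule group_hom.subgroup_kernel)
  then show ?thesis
    unfolding Div0_def by (rule D.subgroup_imp_group)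
qed

definition laplacian_entry :: "'a pair_pre_digraph \<Rightarrow> 'a \<Rightarrow> 'a \<Rightarrow> int" where
  "laplacian_entry G u v = Poly_Mapping.lookup (laplacian G (frag_of v)) u"

lemma lookup_laplacian:
  assumes "finite V" "Poly_Mapping.keys D \<subseteq> V"
  shows "Poly_Mapping.lookup (laplacian G D) u =
    (\<Sum>v\<in>V. laplacian_entry G u v * Poly_Mapping.lookup D v)"
proof -
  have "Poly_Mapping.lookup (laplacian G D) u =
      (\<Sum>v\<in>Poly_Mapping.keys D. laplacian_entry G u v * Poly_Mapping.lookup D v)"
    by (simp add: laplacian_entry_def laplacian_def frag_extend_def[of _ D] lookup_sum mult.commute)
  also have "\<dots> = (\<Sum>v\<in>V. laplacian_entry G u v * Poly_Mapping.lookup D v)"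
    using assms by (intro sum.mono_neutral_left) (auto simp: in_keys_iff)
  finally show ?thesis .
qed

context pair_graph
begin

lemma parcs_sym: "(u, v) \<in> parcs G \<longleftrightarrow> (v, u) \<in> parcs G"
  using pair_sym_arcs by (auto simp: symmetric_def dest: symD)

lemma finite_neighbours: "finite {v. (u, v) \<in> parcs G}"
  by (rule finite_subset[OF _ pair_finite_verts]) (auto dest: in_arcsD2)

lemma laplacian_entry_eq:
  "laplacian_entry G u v =
    (if u = v then int (card {w. (u, w) \<in> parcs G}) else 0) - (if (u, v) \<in> parcs G then 1 else 0)"
proof -
  have "out_arcs (with_proj G) v = Pair v ` {w. (v, w) \<in> parcs G}"
    by (auto simp: out_arcs_def)
  then have "out_degree (with_proj G) v = card {w. (v, w) \<in> parcs G}"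
    by (simp add: out_degree_def card_image inj_on_def)
  moreover have "(\<Sum>w | (w, v) \<in> parcs G. if u = w then 1 else 0) =
      (if (u, v) \<in> parcs G then 1 else 0 :: int)"
    using finite_neighbours[of v] by (simp add: parcs_sym[of _ v])
  ultimately show ?thesis
    by (simp add: laplacian_entry_def laplacian_def lookup_minus lookup_sum)
qed

lemma laplacian_entry_sym: "laplacian_entry G u v = laplacian_entry G v u"
  using parcs_sym[of u v] by (simp add: laplacian_entry_eq)

lemma sum_laplacian_entry_mult:
  assumes "u \<in> pverts G"
  shows "(\<Sum>v\<in>pverts G. laplacian_entry G u v * g v) = (\<Sum>v | (u, v) \<in> parcs G. g u - g v)"
proof -
  have "laplacian_entry G u v * g v =
      (if u = v then int (card {w. (u, w) \<in> parcs G}) * g u else 0) -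
      (if v \<in> {v. (u, v) \<in> parcs G} then g v else 0)" for v
    by (simp add: laplacian_entry_eq left_diff_distrib)
  moreover have "pverts G \<inter> {v. (u, v) \<in> parcs G} = {v. (u, v) \<in> parcs G}"
    by (auto dest: in_arcsD2)
  ultimately show ?thesis
    using assms sum.inter_restrict[OF pair_finite_verts, of g "{v. (u, v) \<in> parcs G}"]
    by (simp add: sum_subtractf)
qed

lemma sum_laplacian_entry_row: "u \<in> pverts G \<Longrightarrow> (\<Sum>v\<in>pverts G. laplacian_entry G u v) = 0"
  using sum_laplacian_entry_mult[of u "\<lambda>_. 1"] by simp

lemma sum_laplacian_entry_col: "v \<in> pverts G \<Longrightarrow> (\<Sum>u\<in>pverts G. laplacian_entry G u v) = 0"
  using sum_laplacian_entry_row[of v] by (simp add: laplacian_entry_sym[of v])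

lemma connected_imp_reachable:
  assumes "Digraph_Component.connected (with_proj G)" "u \<in> pverts G" "v \<in> pverts G"
  shows "u \<rightarrow>\<^sup>*\<^bsub>with_proj G\<^esub> v"
  using symmetric_connected_imp_strongly_connected[OF pair_sym_arcs assms(1)] assms(2,3)
  by (simp add: strongly_connected_def)

text \<open>Maximum principle: the set where the maximum is attained is closed under adjacency.\<close>

lemma harmonic_imp_constant:
  fixes g :: "'a \<Rightarrow> 'b :: linordered_ab_group_add"
  assumes conn: "Digraph_Component.connected (with_proj G)"
    and harmonic: "\<And>u. u \<in> pverts G \<Longrightarrow> (\<Sum>v | (u, v) \<in> parcs G. g u - g v) = 0"
    and uv: "u \<in> pverts G" "v \<in> pverts G"
  shows "g u = g v"
proof -
  have "Max (g ` pverts G) \<in> g ` pverts G"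
    using uv(1) by (intro Max_in) auto
  then obtain m where m: "m \<in> pverts G" "g m = Max (g ` pverts G)"
    by auto
  then have le: "g x \<le> g m" if "x \<in> pverts G" for x
    using that by simp
  have "g x = g m" if "x \<in> pverts G" for x
    using connected_imp_reachable[OF conn m(1) that]
  proof (induction rule: reachable_induct)
    case (step x y)
    then have xy: "(x, y) \<in> parcs G" "x \<in> pverts G"
      by (auto dest: in_arcsD1)
    have "g x - g z \<ge> 0" if "(x, z) \<in> parcs G" for z
      using le[of z] step.IH that by (auto dest: in_arcsD2)
    then have "\<forall>z\<in>{v. (x, v) \<in> parcs G}. g x - g z = 0"
      using sum_nonneg_eq_0_iff[OF finite_neighbours, of x "\<lambda>z. g x - g z"] harmonic[OF xy(2)]
      by blast
    then have "g x - g y = 0"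
      using xy(1) by blast
    then show ?case
      using step.IH by simp
  qed simp
  then show ?thesis
    using uv by simp
qed

end

definition shifted_laplacian :: "'a pair_pre_digraph \<Rightarrow> 'b :: ring_1 \<Rightarrow> 'a \<Rightarrow> 'a \<Rightarrow> 'b" where
  "shifted_laplacian G c u v = of_int (laplacian_entry G u v) + (if u = v then c else 0) + 1"

locale rooted_pair_graph = pair_graph G for G :: "'a pair_pre_digraph" +
  fixes v0 :: 'a and ws :: "'a list"
  assumes distinct_verts: "distinct (v0 # ws)" and set_verts: "set (v0 # ws) = pverts G"
begin

lemma card_verts: "card (pverts G) = length ws + 1"
  using distinct_card[OF distinct_verts] unfolding set_verts by simp

lemma distinct_ws: "distinct ws" and v0_notin_ws: "v0 \<notin> set ws"
  using distinct_verts by simp_all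

lemma v0_in_verts: "v0 \<in> pverts G" and ws_in_verts: "w \<in> set ws \<Longrightarrow> w \<in> pverts G"
  by (auto simp flip: set_verts)

lemma sum_verts: "(\<Sum>u\<in>pverts G. f u) = f v0 + (\<Sum>w\<in>set ws. f w)"
  using v0_notin_ws by (simp flip: set_verts)

subsection \<open>The Picard group as a cokernel\<close>

definition rooted_div :: "('a \<Rightarrow> int) \<Rightarrow> ('a \<Rightarrow>\<^sub>0 int)" where
  "rooted_div g = (\<Sum>w\<in>set ws. frag_cmul (g w) (frag_of w - frag_of v0))"

lemma lookup_rooted_div:
  "Poly_Mapping.lookup (rooted_div g) u =
    (if u \<in> set ws then g u else if u = v0 then - (\<Sum>w\<in>set ws. g w) else 0)"
proof -
  have "Poly_Mapping.lookup (rooted_div g) u =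
      (\<Sum>w\<in>set ws. (if w = u then g w else 0) - (if v0 = u then g w else 0))"
    unfolding rooted_div_def lookup_sum by (intro sum.cong) (auto simp: lookup_minus)
  then show ?thesis
    using v0_notin_ws by (auto simp: sum_subtractf)
qed

lemma rooted_div_in_Div0: "rooted_div g \<in> carrier (Div0 G)"
proof -
  have "Poly_Mapping.keys (rooted_div g) \<subseteq> pverts G"
    using v0_in_verts ws_in_verts by (auto simp: in_keys_iff lookup_rooted_div split: if_splits)
  moreover have "div_degree (rooted_div g) = 0"
    by (simp add: rooted_div_def div_degree_sum div_degree_cmul div_degree_diff)
  ultimately show ?thesis
    by (simp add: carrier_Div0)
qed

lemma rooted_div_lookup:
  assumes "D \<in> carrier (Div0 G)"
  shows "rooted_div (Poly_Mapping.lookup D) = D"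
proof (rule poly_mapping_eqI)
  fix u
  have D: "Poly_Mapping.keys D \<subseteq> pverts G" "(\<Sum>u\<in>pverts G. Poly_Mapping.lookup D u) = 0"
    using assms div_degree_superset[OF pair_finite_verts, of D] by (simp_all add: carrier_Div0)
  consider (other) "u \<in> set ws" | (root) "u = v0" | (outside) "u \<notin> pverts G"
    using set_verts by auto
  then show "Poly_Mapping.lookup (rooted_div (Poly_Mapping.lookup D)) u = Poly_Mapping.lookup D u"
  proof cases
    case root
    then show ?thesis
      using D(2) v0_notin_ws by (simp add: lookup_rooted_div sum_verts)
  next
    case outside
    then show ?thesis
      using D(1) ws_in_verts v0_in_verts by (auto simp: lookup_rooted_div in_keys_iff)
  qed (simp add: lookup_rooted_div)
qed

lemma lookup_laplacian_rooted:
  assumes "Z \<in> carrier (Div G)" "u \<in> pverts G"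
  shows "Poly_Mapping.lookup (laplacian G Z) u =
    (\<Sum>w\<in>set ws. laplacian_entry G u w * (Poly_Mapping.lookup Z w - Poly_Mapping.lookup Z v0))"
proof -
  have "Poly_Mapping.lookup (laplacian G Z) u =
      (\<Sum>w\<in>pverts G. laplacian_entry G u w * Poly_Mapping.lookup Z w) -
      (\<Sum>w\<in>pverts G. laplacian_entry G u w) * Poly_Mapping.lookup Z v0"
    using assms
    by (simp add: lookup_laplacian[OF pair_finite_verts] carrier_Div sum_laplacian_entry_row)
  also have "\<dots> =
      (\<Sum>w\<in>pverts G. laplacian_entry G u w * (Poly_Mapping.lookup Z w - Poly_Mapping.lookup Z v0))"
    by (simp add: sum_distrib_right sum_subtractf right_diff_distrib)
  finally show ?thesis
    by (simp add: sum_verts)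
qed

abbreviation reduced_laplacian :: "int mat" where
  "reduced_laplacian \<equiv> list_mat ws (laplacian_entry G)"

lemma list_vec_laplacian:
  assumes "Z \<in> carrier (Div G)"
  shows "list_vec ws (Poly_Mapping.lookup (laplacian G Z)) =
    reduced_laplacian *\<^sub>v list_vec ws (\<lambda>w. Poly_Mapping.lookup Z w - Poly_Mapping.lookup Z v0)"
  using assms ws_in_verts
  by (simp add: list_mat_mult_list_vec[OF distinct_ws] list_vec_eq_iff lookup_laplacian_rooted)

lemma laplacian_image_eq:
  "laplacian G ` carrier (Div G) =
    {D \<in> carrier (Div0 G). list_vec ws (Poly_Mapping.lookup D) \<in> mat_range reduced_laplacian}"
  (is "_ = ?R")
proof (intro equalityI subsetI)
  fix D assume "D \<in> laplacian G ` carrier (Div G)"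
  then show "D \<in> ?R"
    using laplacian_in_Div0 list_vec_laplacian by (auto simp: mat_range_def)
next
  fix D assume "D \<in> ?R"
  then obtain z where D: "D \<in> carrier (Div0 G)" and z: "z \<in> carrier_vec (length ws)"
      "list_vec ws (Poly_Mapping.lookup D) = reduced_laplacian *\<^sub>v z"
    by (auto simp: mat_range_def)
  obtain g where g: "z = list_vec ws g"
    using exists_list_vec[OF distinct_ws z(1)] by blast
  define Z where "Z = rooted_div g + frag_cmul (\<Sum>w\<in>set ws. g w) (frag_of v0)"
  have Z: "Z \<in> carrier (Div G)"
    using rooted_div_in_Div0[of g] v0_in_verts
      keys_add[of "rooted_div g" "frag_cmul (\<Sum>w\<in>set ws. g w) (frag_of v0)"]
    by (auto simp: Z_def carrier_Div carrier_Div0)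
  have "list_vec ws (\<lambda>w. Poly_Mapping.lookup Z w - Poly_Mapping.lookup Z v0) = z"
    using v0_notin_ws by (auto simp: g list_vec_eq_iff Z_def lookup_add lookup_rooted_div)
  then have "list_vec ws (Poly_Mapping.lookup (laplacian G Z)) =
      list_vec ws (Poly_Mapping.lookup D)"
    using list_vec_laplacian[OF Z] z(2) by simp
  then have "rooted_div (Poly_Mapping.lookup (laplacian G Z)) = rooted_div (Poly_Mapping.lookup D)"
    by (simp add: rooted_div_def list_vec_eq_iff)
  then have "laplacian G Z = D"
    using D laplacian_in_Div0[OF Z] by (simp add: rooted_div_lookup)
  then show "D \<in> laplacian G ` carrier (Div G)"
    using Z by blast
qed

lemma Pic0_iso_mat_cokernel: "Pic0 G \<cong> mat_cokernel reduced_laplacian"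
proof -
  let ?h = "\<lambda>D. list_vec ws (Poly_Mapping.lookup D)"
  let ?Zn = "monoid_vec TYPE(int) (length ws)"
  have "?h \<in> hom (Div0 G) ?Zn"
    by (auto simp: hom_def monoid_vec_simps Div0_def Div_def lookup_add list_vec_add)
  then interpret h: group_hom "Div0 G" ?Zn ?h
    using group_Div0[of G] comm_group_vec[where 'a = int]
    by (simp add: group_hom_def group_hom_axioms_def comm_group_def)
  have "w \<in> ?h ` carrier (Div0 G)" if w: "w \<in> carrier_vec (length ws)" for w
  proof -
    obtain g where "w = list_vec ws g"
      using exists_list_vec[OF distinct_ws w] by blast
    then have "w = ?h (rooted_div g)"
      by (simp add: list_vec_eq_iff lookup_rooted_div)
    then show ?thesis
      using rooted_div_in_Div0 by blast
  qed
  then have "?h ` carrier (Div0 G) = carrier ?Zn"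
    by (auto simp: monoid_vec_simps)
  then have "Div0 G Mod {D \<in> carrier (Div0 G). ?h D \<in> mat_range reduced_laplacian} \<cong>
      ?Zn Mod mat_range reduced_laplacian"
    using normal_mat_range[of reduced_laplacian] by (intro h.FactGroup_vimage_iso) simp_all
  then show ?thesis
    unfolding Pic0_def laplacian_image_eq mat_cokernel_def by simp
qed

lemma det_reduced_laplacian_nonzero:
  assumes "Digraph_Component.connected (with_proj G)"
  shows "det reduced_laplacian \<noteq> 0"
proof
  assume "det reduced_laplacian = 0"
  then obtain g w where w: "w \<in> set ws" "g w \<noteq> 0"
    and ker: "\<And>u. u \<in> set ws \<Longrightarrow> (\<Sum>y\<in>set ws. laplacian_entry G u y * g y) = 0"
    by (auto simp: det_list_mat_eq_0_iff[OF distinct_ws])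
  define h where "h = g(v0 := 0)"
  let ?L = "\<lambda>u. \<Sum>y\<in>pverts G. laplacian_entry G u y * h y"
  have L_ws: "?L u = 0" if "u \<in> set ws" for u
  proof -
    have "?L u = (\<Sum>y\<in>set ws. laplacian_entry G u y * g y)"
      using v0_notin_ws unfolding sum_verts by (auto simp: h_def intro!: sum.cong)
    then show ?thesis
      using ker[OF that] by simp
  qed
  moreover have "?L v0 = 0"
  proof -
    have "(\<Sum>u\<in>pverts G. ?L u) = (\<Sum>y\<in>pverts G. (\<Sum>u\<in>pverts G. laplacian_entry G u y) * h y)"
      unfolding sum_distrib_right by (rule sum.swap)
    also have "\<dots> = 0"
      by (simp add: sum_laplacian_entry_col)
    finally show ?thesis
      using L_ws unfolding sum_verts[of ?L] by simp
  qed
  ultimately have "?L u = 0" if "u \<in> pverts G" for u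
    using that by (auto simp flip: set_verts)
  then have "h w = h v0"
    using assms w(1) v0_in_verts ws_in_verts sum_laplacian_entry_mult[of _ h]
    by (intro harmonic_imp_constant) simp_all
  then show False
    using w v0_notin_ws by (auto simp: h_def split: if_splits)
qed

lemma card_Pic0:
  assumes "Digraph_Component.connected (with_proj G)"
  shows "finite (carrier (Pic0 G))" "int (card (carrier (Pic0 G))) = \<bar>det reduced_laplacian\<bar>"
  using card_mat_cokernel[OF list_mat_carrier det_reduced_laplacian_nonzero[OF assms]]
    iso_same_card[OF Pic0_iso_mat_cokernel] iso_finite[OF Pic0_iso_mat_cokernel] by simp_all

subsection \<open>Shifted Laplacians and the characteristic polynomial\<close>

definition div0_laplacian :: "'a \<Rightarrow> 'a \<Rightarrow> int" where
  "div0_laplacian x y = laplacian_entry G x y - laplacian_entry G x v0"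

lemma laplacian_entry_root:
  "u \<in> pverts G \<Longrightarrow> laplacian_entry G u v0 = - (\<Sum>w\<in>set ws. laplacian_entry G u w)"
  using sum_laplacian_entry_row[of u] by (simp add: sum_verts)

lemma det_shifted_laplacian:
  fixes c :: "'b :: idom"
  shows "det (list_mat (v0 # ws) (shifted_laplacian G c)) = (c + of_nat (card (pverts G))) *
    det (list_mat ws (\<lambda>x y. of_int (div0_laplacian x y) + (if x = y then c else 0)))"
proof -
  have "(\<Sum>x\<in>set (v0 # ws). shifted_laplacian G c x y) = c + of_nat (card (pverts G))"
    if "y \<in> set (v0 # ws)" for y
    using that sum_laplacian_entry_col[of y] unfolding set_verts shifted_laplacian_def
    by (simp add: sum.distrib flip: of_int_sum)
  then have "det (list_mat (v0 # ws) (shifted_laplacian G c)) = (c + of_nat (card (pverts G))) *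
      det (list_mat ws (\<lambda>x y. shifted_laplacian G c x y - shifted_laplacian G c x v0))"
    by (rule det_list_mat_const_col_sum[OF distinct_verts])
  also have "list_mat ws (\<lambda>x y. shifted_laplacian G c x y - shifted_laplacian G c x v0) =
      list_mat ws (\<lambda>x y. of_int (div0_laplacian x y) + (if x = y then c else 0))"
    using v0_notin_ws by (auto simp: list_mat_eq_iff shifted_laplacian_def div0_laplacian_def)
  finally show ?thesis .
qed

lemma det_div0_laplacian:
  "det (list_mat ws div0_laplacian) = int (card (pverts G)) * det reduced_laplacian"
proof -
  have "list_mat ws div0_laplacian =
      list_mat ws (\<lambda>x y. laplacian_entry G x y + (\<Sum>z\<in>set ws. laplacian_entry G x z))"
    using ws_in_verts by (simp add: list_mat_eq_iff div0_laplacian_def laplacian_entry_root)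
  then show ?thesis
    by (simp add: det_list_mat_add_row_sum[OF distinct_ws] card_verts)
qed

lemma det_shifted_laplacian_0:
  "det (list_mat (v0 # ws) (shifted_laplacian G 0)) =
    (of_nat (card (pverts G)))\<^sup>2 * (of_int (det reduced_laplacian) :: 'b :: idom)"
proof -
  have "det (list_mat ws (\<lambda>x y. of_int (div0_laplacian x y) :: 'b)) =
      of_nat (card (pverts G)) * of_int (det reduced_laplacian)"
    by (simp add: det_div0_laplacian flip: of_int_det_list_mat)
  then show ?thesis
    by (simp add: det_shifted_laplacian power2_eq_square)
qed

abbreviation root_diff :: "'a \<Rightarrow> ('a \<Rightarrow>\<^sub>0 rat)" where
  "root_diff w \<equiv> rat_div (frag_of w - frag_of v0)"

lemma lookup_root_diff:
  "u \<in> set ws \<Longrightarrow> Poly_Mapping.lookup (root_diff w) u = (if u = w then 1 else 0)"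
  using v0_notin_ws by (auto simp: lookup_minus)

lemma inj_on_root_diff: "inj_on root_diff (set ws)"
  by (rule inj_onI) (metis lookup_root_diff zero_neq_one)

lemma lookup_sum_root_diff:
  assumes "u \<in> set ws"
  shows "Poly_Mapping.lookup (\<Sum>b\<in>root_diff ` set ws. rat_scale (f b) b) u = f (root_diff u)"
proof -
  have "Poly_Mapping.lookup (\<Sum>b\<in>root_diff ` set ws. rat_scale (f b) b) u =
      (\<Sum>w\<in>set ws. f (root_diff w) * Poly_Mapping.lookup (root_diff w) u)"
    by (simp add: sum.reindex[OF inj_on_root_diff] lookup_sum del: lookup_rat_div)
  then show ?thesis
    using assms
    by (simp add: lookup_root_diff if_distrib[of "\<lambda>x. _ * x"] cong: if_cong del: lookup_rat_div)
qed

lemma independent_root_diff: "ratvs.independent (root_diff ` set ws)"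
proof (rule ratvs.independent_if_scalars_zero)
  fix f b assume "(\<Sum>b\<in>root_diff ` set ws. rat_scale (f b) b) = 0" "b \<in> root_diff ` set ws"
  then show "f b = 0"
    using lookup_sum_root_diff[of _ f] by auto
qed simp

lemma span_root_diff: "ratvs.span (root_diff ` set ws) = Div0_rat G"
proof
  have "frag_of w - frag_of v0 \<in> carrier (Div0 G)" if "w \<in> set ws" for w
    using that v0_in_verts ws_in_verts keys_diff[of "frag_of w" "frag_of v0"]
    by (auto simp: carrier_Div0 div_degree_diff)
  then show "ratvs.span (root_diff ` set ws) \<subseteq> Div0_rat G"
    unfolding Div0_rat_def by (intro ratvs.span_mono) auto
  have "rat_div D \<in> ratvs.span (root_diff ` set ws)" if "D \<in> carrier (Div0 G)" for D
  proof -
    have "rat_div (\<Sum>w\<in>A. frag_cmul (g w) (frag_of w - frag_of v0)) =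
        (\<Sum>w\<in>A. rat_scale (of_int (g w)) (root_diff w))" for g A
      by (induction A rule: infinite_finite_induct) (simp_all add: rat_div_add rat_div_cmul)
    then have "rat_div D = (\<Sum>w\<in>set ws. rat_scale (of_int (Poly_Mapping.lookup D w)) (root_diff w))"
      using rooted_div_lookup[OF that] by (metis rooted_div_def)
    then show ?thesis
      by (auto intro: ratvs.span_sum ratvs.span_scale ratvs.span_base)
  qed
  then show "Div0_rat G \<subseteq> ratvs.span (root_diff ` set ws)"
    unfolding Div0_rat_def by (intro ratvs.span_minimal) auto
qed

lemma representation_root_diff:
  assumes "x \<in> Div0_rat G" "w \<in> set ws"
  shows "ratvs.representation (root_diff ` set ws) x (root_diff w) = Poly_Mapping.lookup x w"
proof -
  have "(\<Sum>b\<in>root_diff ` set ws. rat_scale (ratvs.representation (root_diff ` set ws) x b) b) = x"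
    using assms(1)
    by (intro ratvs.sum_representation_eq independent_root_diff) (simp_all add: span_root_diff)
  then show ?thesis
    using lookup_sum_root_diff[OF assms(2), of "ratvs.representation (root_diff ` set ws) x"]
    by simp
qed

lemma is_ordered_basis_root_diff: "is_ordered_basis (map root_diff ws) (Div0_rat G)"
  using distinct_ws inj_on_root_diff independent_root_diff span_root_diff
  by (simp add: is_ordered_basis_def distinct_map)

lemma endo_matrix_rat_laplacian:
  "endo_matrix (map root_diff ws) (rat_laplacian G) =
    list_mat ws (\<lambda>x y. of_int (div0_laplacian x y))" (is "?A = ?B")
proof (rule eq_matI)
  fix i j assume "i < dim_row ?B" "j < dim_col ?B"
  then have ij: "i < length ws" "j < length ws"
    by simp_all
  let ?D = "frag_of (ws ! j) - frag_of v0"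
  have "root_diff (ws ! j) \<in> Div0_rat G"
    using ij(2) ratvs.span_base[of "root_diff (ws ! j)" "root_diff ` set ws"]
    by (simp add: span_root_diff)
  then have "rat_laplacian G (root_diff (ws ! j)) \<in> Div0_rat G"
    by (rule rat_laplacian_in_Div0_rat)
  then have "?A $$ (i, j) = Poly_Mapping.lookup (rat_div (laplacian G ?D)) (ws ! i)"
    using ij
    by (simp add: endo_matrix_def representation_root_diff rat_laplacian_rat_div del: lookup_rat_div)
  also have "\<dots> = ?B $$ (i, j)"
    using ij
    by (simp add: div0_laplacian_def laplacian_entry_def laplacian_def frag_extend_diff lookup_minus)
  finally show "?A $$ (i, j) = ?B $$ (i, j)" .
qed (simp_all add: endo_matrix_def)

lemma graph_char_poly_eq:
  "graph_char_poly G =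
    char_poly (list_mat ws (\<lambda>x y. of_int (div0_laplacian x y)))"
  unfolding graph_char_poly_def endo_matrix_rat_laplacian[symmetric]
  using is_ordered_basis_root_diff linear_rat_laplacian rat_laplacian_in_Div0_rat
  by (intro endo_char_poly_eq) auto

lemma abs_poly_graph_char_poly:
  "\<bar>poly (graph_char_poly G) (- c)\<bar> = \<bar>det (list_mat ws
    (\<lambda>x y. of_int (div0_laplacian x y) + (if x = y then c else 0)))\<bar>"
  (is "_ = \<bar>det ?B\<bar>")
proof -
  let ?A = "list_mat ws (\<lambda>x y. of_int (div0_laplacian x y) :: rat)"
  have "char_matrix ?A (- c) = ?B"
    using distinct_ws by (intro eq_matI) (auto simp: char_matrix_def nth_eq_iff_index_eq)
  then have "poly (graph_char_poly G) (- c) = det (- ?B)"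
    using char_poly_matrix[of ?A "length ws" "- c"] by (simp add: graph_char_poly_eq)
  also have "- ?B = (- 1) \<cdot>\<^sub>m ?B"
    by (rule eq_matI) simp_all
  finally show ?thesis
    by (simp add: abs_mult power_abs)
qed

end

lemma (in pair_graph) rooted_pair_graph_enumeration:
  assumes "distinct vs" "set vs = pverts G" "pverts G \<noteq> {}"
  obtains v0 ws where "vs = v0 # ws" "rooted_pair_graph G v0 ws"
  using assms that pair_graph_axioms
  by (cases vs) (auto simp: rooted_pair_graph_def rooted_pair_graph_axioms_def)

lemma (in pair_graph) abs_det_shifted_laplacian:
  assumes "distinct vs" "set vs = pverts G" "pverts G \<noteq> {}"
  shows "\<bar>det (list_mat vs (shifted_laplacian G c))\<bar> =
    \<bar>c + of_nat (card (pverts G))\<bar> * \<bar>poly (graph_char_poly G) (- c)\<bar>"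
proof -
  obtain v0 ws where vs: "vs = v0 # ws" and "rooted_pair_graph G v0 ws"
    using rooted_pair_graph_enumeration[OF assms] .
  then interpret rooted_pair_graph G v0 ws
    by simp
  show ?thesis
    by (simp add: vs det_shifted_laplacian abs_mult abs_poly_graph_char_poly)
qed

lemma (in pair_graph) card_Pic0_eq_det:
  assumes vs: "distinct vs" "set vs = pverts G"
    and conn: "Digraph_Component.connected (with_proj G)"
  shows "finite (carrier (Pic0 G))"
    and "(of_nat (card (pverts G)))\<^sup>2 * of_nat (card (carrier (Pic0 G))) =
      \<bar>det (list_mat vs (shifted_laplacian G 0)) :: rat\<bar>"
proof -
  obtain v0 ws where "vs = v0 # ws" and "rooted_pair_graph G v0 ws"
    using rooted_pair_graph_enumeration[OF vs connected_imp_pverts_nonempty[OF conn]] .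
  then interpret rooted_pair_graph G v0 ws
    by simp
  show "finite (carrier (Pic0 G))"
    using conn by (rule card_Pic0(1))
  have "(of_nat (card (carrier (Pic0 G))) :: rat) = \<bar>of_int (det reduced_laplacian)\<bar>"
    using card_Pic0(2)[OF conn] by (metis of_int_abs of_int_of_nat_eq)
  then show "(of_nat (card (pverts G)))\<^sup>2 * of_nat (card (carrier (Pic0 G))) =
      \<bar>det (list_mat vs (shifted_laplacian G 0)) :: rat\<bar>"
    by (simp add: \<open>vs = v0 # ws\<close> det_shifted_laplacian_0 abs_mult)
qed

section \<open>Joins\<close>

lemma pverts_graph_join: "pverts (graph_join l \<Gamma>) = (SIGMA i:{1..l}. pverts (\<Gamma> i))"
  by (simp add: graph_join_def)

lemma parcs_graph_join_iff:
  "((i, u), (j, v)) \<in> parcs (graph_join l \<Gamma>) \<longleftrightarrow> i \<in> {1..l} \<and> j \<in> {1..l} \<and>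
    (if i = j then (u, v) \<in> parcs (\<Gamma> i) else u \<in> pverts (\<Gamma> i) \<and> v \<in> pverts (\<Gamma> j))"
  by (auto simp: graph_join_def)

locale pair_graph_family =
  fixes l :: nat and \<Gamma> :: "nat \<Rightarrow> 'a pair_pre_digraph"
  assumes pair_graph_\<Gamma>: "i \<in> {1..l} \<Longrightarrow> pair_graph (\<Gamma> i)"
begin

abbreviation \<Gamma>\<^sub>J :: "(nat \<times> 'a) pair_pre_digraph" where
  "\<Gamma>\<^sub>J \<equiv> graph_join l \<Gamma>"

lemma finite_verts: "i \<in> {1..l} \<Longrightarrow> finite (pverts (\<Gamma> i))"
  using pair_graph_\<Gamma>
  by (simp add: pair_graph_def pair_digraph_def pair_fin_digraph.pair_finite_verts)

lemma card_verts_join: "card (pverts \<Gamma>\<^sub>J) = (\<Sum>i=1..l. card (pverts (\<Gamma> i)))"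
  unfolding pverts_graph_join using finite_verts by (intro card_SigmaI) simp_all

lemma pair_graph_join: "pair_graph \<Gamma>\<^sub>J"
proof
  have \<Gamma>: "pair_wf_digraph (\<Gamma> i)" "pair_sym_digraph (\<Gamma> i)" "pair_loopfree_digraph (\<Gamma> i)"
    if "i \<in> {1..l}" for i
    using pair_graph_\<Gamma>[OF that]
    by (simp_all add: pair_graph_def pair_digraph_def pair_pseudo_graph_def pair_fin_digraph_def)
  have arcs: "parcs \<Gamma>\<^sub>J \<subseteq> pverts \<Gamma>\<^sub>J \<times> pverts \<Gamma>\<^sub>J"
  proof (rule subrelI)
    fix p q assume "(p, q) \<in> parcs \<Gamma>\<^sub>J"
    then show "(p, q) \<in> pverts \<Gamma>\<^sub>J \<times> pverts \<Gamma>\<^sub>J"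
      using \<Gamma>(1) by (cases p; cases q)
        (auto simp: pverts_graph_join parcs_graph_join_iff split: if_splits
          dest: pair_wf_digraph.in_arcsD1 pair_wf_digraph.in_arcsD2)
  qed
  then show "fst e \<in> pverts \<Gamma>\<^sub>J" "snd e \<in> pverts \<Gamma>\<^sub>J" if "e \<in> parcs \<Gamma>\<^sub>J" for e
    using that by auto
  show finite: "finite (pverts \<Gamma>\<^sub>J)"
    unfolding pverts_graph_join using finite_verts by (rule finite_SigmaI[OF finite_atLeastAtMost])
  show "finite (parcs \<Gamma>\<^sub>J)"
    using finite_subset[OF arcs] finite by simp
  show "fst e \<noteq> snd e" if "e \<in> parcs \<Gamma>\<^sub>J" for e
    using that pair_loopfree_digraph.pair_no_loops[OF \<Gamma>(3)]
    by (cases e; cases "fst e"; cases "snd e")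
      (fastforce simp: parcs_graph_join_iff split: if_splits)
  show "symmetric \<Gamma>\<^sub>J"
  proof -
    have "sym (parcs \<Gamma>\<^sub>J)"
    proof (rule symI)
      fix p q assume "(p, q) \<in> parcs \<Gamma>\<^sub>J"
      then show "(q, p) \<in> parcs \<Gamma>\<^sub>J"
        using pair_sym_digraph.pair_sym_arcs[OF \<Gamma>(2)]
        by (cases p; cases q)
          (auto simp: symmetric_def parcs_graph_join_iff split: if_splits dest: symD)
    qed
    then show ?thesis
      by (simp add: symmetric_def)
  qed
qed

sublocale J: pair_graph \<Gamma>\<^sub>J
  by (rule pair_graph_join)

lemma degree_join:
  assumes "i \<in> {1..l}" "u \<in> pverts (\<Gamma> i)"
  shows "card {w. ((i, u), w) \<in> parcs \<Gamma>\<^sub>J} + card (pverts (\<Gamma> i)) =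
    card {w. (u, w) \<in> parcs (\<Gamma> i)} + card (pverts \<Gamma>\<^sub>J)"
proof -
  interpret \<Gamma>i: pair_graph "\<Gamma> i"
    using assms(1) by (rule pair_graph_\<Gamma>)
  let ?N = "Pair i ` {w. (u, w) \<in> parcs (\<Gamma> i)}" and ?Vi = "Pair i ` pverts (\<Gamma> i)"
  have sub: "?Vi \<subseteq> pverts \<Gamma>\<^sub>J"
    using assms(1) by (auto simp: pverts_graph_join)
  have "{w. ((i, u), w) \<in> parcs \<Gamma>\<^sub>J} = ?N \<union> (pverts \<Gamma>\<^sub>J - ?Vi)"
    using assms by (auto simp: pverts_graph_join parcs_graph_join_iff split: if_splits)
  moreover have "?N \<inter> (pverts \<Gamma>\<^sub>J - ?Vi) = {}"
    by (auto dest: \<Gamma>i.in_arcsD2)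
  ultimately have "card {w. ((i, u), w) \<in> parcs \<Gamma>\<^sub>J} = card ?N + card (pverts \<Gamma>\<^sub>J - ?Vi)"
    using \<Gamma>i.finite_neighbours[of u] J.pair_finite_verts
    by (simp only: card_Un_disjoint finite_imageI finite_Diff)
  moreover have "card (pverts \<Gamma>\<^sub>J - ?Vi) + card ?Vi = card (pverts \<Gamma>\<^sub>J)"
    using card_mono[OF J.pair_finite_verts sub] sub
    by (simp add: card_Diff_subset finite_subset[OF sub J.pair_finite_verts])
  moreover have "card ?N = card {w. (u, w) \<in> parcs (\<Gamma> i)}" "card ?Vi = card (pverts (\<Gamma> i))"
    by (simp_all add: card_image inj_on_def)
  ultimately show ?thesis
    by linarith
qed

lemma shifted_laplacian_join:
  assumes ij: "i \<in> {1..l}" "j \<in> {1..l}" and uv: "u \<in> pverts (\<Gamma> i)" "v \<in> pverts (\<Gamma> j)"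
  shows "shifted_laplacian \<Gamma>\<^sub>J c (i, u) (j, v) =
    (if i = j
     then shifted_laplacian (\<Gamma> i) (c + of_nat (card (pverts \<Gamma>\<^sub>J)) - of_nat (card (pverts (\<Gamma> i)))) u v
     else 0)"
proof -
  interpret \<Gamma>i: pair_graph "\<Gamma> i"
    using ij(1) by (rule pair_graph_\<Gamma>)
  have "of_nat (card {w. ((i, u), w) \<in> parcs \<Gamma>\<^sub>J}) =
      of_nat (card {w. (u, w) \<in> parcs (\<Gamma> i)}) +
        of_nat (card (pverts \<Gamma>\<^sub>J)) - (of_nat (card (pverts (\<Gamma> i))) :: 'b :: ring_1)"
    using degree_join[OF ij(1) uv(1)] by (simp add: eq_diff_eq flip: of_nat_add)
  then show ?thesis
    using ij uv unfolding shifted_laplacian_def J.laplacian_entry_eq \<Gamma>i.laplacian_entry_eq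
    by (auto simp: parcs_graph_join_iff algebra_simps)
qed

lemma det_shifted_laplacian_join:
  fixes c :: "'b :: idom"
  assumes "set is = {1..l}" "distinct is" and xs: "\<And>i. i \<in> {1..l} \<Longrightarrow> set (xs i) = pverts (\<Gamma> i)"
  shows "det (list_mat (list_Sigma is xs) (shifted_laplacian \<Gamma>\<^sub>J c)) =
    (\<Prod>i=1..l. det (list_mat (xs i)
      (shifted_laplacian (\<Gamma> i) (c + of_nat (card (pverts \<Gamma>\<^sub>J)) - of_nat (card (pverts (\<Gamma> i)))))))"
proof -
  have "det (list_mat (list_Sigma is xs) (shifted_laplacian \<Gamma>\<^sub>J c)) =
      (\<Prod>i\<in>set is. det (list_mat (xs i) (\<lambda>u v. shifted_laplacian \<Gamma>\<^sub>J c (i, u) (i, v))))"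
    using assms by (intro det_list_mat_list_Sigma) (simp_all add: shifted_laplacian_join)
  also have "\<dots> = (\<Prod>i=1..l. det (list_mat (xs i)
      (shifted_laplacian (\<Gamma> i) (c + of_nat (card (pverts \<Gamma>\<^sub>J)) - of_nat (card (pverts (\<Gamma> i)))))))"
    using assms(1) xs
    by (intro prod.cong arg_cong[of _ _ det]) (simp_all add: list_mat_eq_iff shifted_laplacian_join)
  finally show ?thesis .
qed

lemma reachable_join:
  assumes conn: "\<And>i. i \<in> {1..l} \<Longrightarrow> Digraph_Component.connected (with_proj (\<Gamma> i))"
    and ij: "i \<in> {1..l}" "j \<in> {1..l}" and uv: "u \<in> pverts (\<Gamma> i)" "v \<in> pverts (\<Gamma> j)"
  shows "(i, u) \<rightarrow>\<^sup>*\<^bsub>with_proj \<Gamma>\<^sub>J\<^esub> (j, v)"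
proof (cases "i = j")
  case True
  interpret \<Gamma>i: pair_graph "\<Gamma> i"
    using ij(1) by (rule pair_graph_\<Gamma>)
  have "u \<rightarrow>\<^sup>*\<^bsub>with_proj (\<Gamma> i)\<^esub> v"
    using \<Gamma>i.connected_imp_reachable[OF conn[OF ij(1)]] uv True by simp
  then have "(i, u) \<rightarrow>\<^sup>*\<^bsub>with_proj \<Gamma>\<^sub>J\<^esub> (i, v)"
  proof (induction rule: \<Gamma>i.reachable_induct)
    case base
    then show ?case
      using ij(1) by (simp add: pverts_graph_join)
  next
    case (step x y)
    then have "((i, x), (i, y)) \<in> parcs \<Gamma>\<^sub>J"
      using ij(1) by (simp add: parcs_graph_join_iff)
    with step.IH show ?case
      by (rule J.reachable_adj_trans)
  qed
  then show ?thesis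
    using True by simp
qed (use ij uv in \<open>simp add: parcs_graph_join_iff\<close>)

lemma connected_join:
  assumes "l \<ge> 1" and conn: "\<And>i. i \<in> {1..l} \<Longrightarrow> Digraph_Component.connected (with_proj (\<Gamma> i))"
  shows "Digraph_Component.connected (with_proj \<Gamma>\<^sub>J)"
proof -
  have "p \<rightarrow>\<^sup>*\<^bsub>mk_symmetric (with_proj \<Gamma>\<^sub>J)\<^esub> q" if "p \<in> pverts \<Gamma>\<^sub>J" "q \<in> pverts \<Gamma>\<^sub>J" for p q
    using that reachable_join[OF conn]
    by (auto simp: pverts_graph_join intro!: J.reachable_mk_symmetricI)
  moreover obtain v where "v \<in> pverts (\<Gamma> 1)"
    using connected_imp_pverts_nonempty[OF conn[of 1]] \<open>l \<ge> 1\<close> by auto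
  then have "(1, v) \<in> pverts \<Gamma>\<^sub>J"
    using \<open>l \<ge> 1\<close> by (simp add: pverts_graph_join)
  ultimately show ?thesis
    by (auto simp: Digraph_Component.connected_def strongly_connected_def)
qed

lemma abs_det_shifted_laplacian_join:
  assumes "set is = {1..l}" "distinct is"
    and xs: "\<And>i. i \<in> {1..l} \<Longrightarrow> set (xs i) = pverts (\<Gamma> i)" "\<And>i. i \<in> {1..l} \<Longrightarrow> distinct (xs i)"
    and nonempty: "\<And>i. i \<in> {1..l} \<Longrightarrow> pverts (\<Gamma> i) \<noteq> {}"
  shows "\<bar>det (list_mat (list_Sigma is xs) (shifted_laplacian \<Gamma>\<^sub>J c))\<bar> =
    \<bar>c + of_nat (card (pverts \<Gamma>\<^sub>J))\<bar> ^ l *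
    (\<Prod>i=1..l. \<bar>poly (graph_char_poly (\<Gamma> i))
      (of_nat (card (pverts (\<Gamma> i))) - of_nat (card (pverts \<Gamma>\<^sub>J)) - c)\<bar>)"
proof -
  let ?K = "of_nat (card (pverts \<Gamma>\<^sub>J)) :: rat" and ?k = "\<lambda>i. of_nat (card (pverts (\<Gamma> i))) :: rat"
  have "\<bar>det (list_mat (list_Sigma is xs) (shifted_laplacian \<Gamma>\<^sub>J c))\<bar> =
      (\<Prod>i=1..l. \<bar>det (list_mat (xs i) (shifted_laplacian (\<Gamma> i) (c + ?K - ?k i)))\<bar>)"
    using det_shifted_laplacian_join[of "is" xs c] assms(1-3) by (simp add: abs_prod)
  also have "\<dots> = (\<Prod>i=1..l. \<bar>c + ?K\<bar> * \<bar>poly (graph_char_poly (\<Gamma> i)) (?k i - ?K - c)\<bar>)"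
  proof (rule prod.cong[OF refl])
    fix i assume i: "i \<in> {1..l}"
    show "\<bar>det (list_mat (xs i) (shifted_laplacian (\<Gamma> i) (c + ?K - ?k i)))\<bar> =
        \<bar>c + ?K\<bar> * \<bar>poly (graph_char_poly (\<Gamma> i)) (?k i - ?K - c)\<bar>"
      using pair_graph.abs_det_shifted_laplacian
        [OF pair_graph_\<Gamma> xs(2,1) nonempty, OF i i i i, of "c + ?K - ?k i"]
      by (simp add: algebra_simps)
  qed
  also have "\<dots> = \<bar>c + ?K\<bar> ^ l * (\<Prod>i=1..l. \<bar>poly (graph_char_poly (\<Gamma> i)) (?k i - ?K - c)\<bar>)"
    by (simp add: prod.distrib)
  finally show ?thesis .
qed

lemma card_Pic0_join:
  assumes "l \<ge> 1" and conn: "\<And>i. i \<in> {1..l} \<Longrightarrow> Digraph_Component.connected (with_proj (\<Gamma> i))"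
  shows "finite (carrier (Pic0 \<Gamma>\<^sub>J))"
    and "(of_nat (card (pverts \<Gamma>\<^sub>J)))\<^sup>2 * of_nat (card (carrier (Pic0 \<Gamma>\<^sub>J))) =
      of_nat (card (pverts \<Gamma>\<^sub>J)) ^ l *
      (\<Prod>i=1..l. \<bar>poly (graph_char_poly (\<Gamma> i))
        (of_nat (card (pverts (\<Gamma> i))) - of_nat (card (pverts \<Gamma>\<^sub>J)))\<bar>)"
proof -
  obtain "is" where "is": "set is = {1..l}" "distinct is"
    using finite_distinct_list[OF finite_atLeastAtMost] by blast
  obtain xs where xs: "\<And>i. i \<in> {1..l} \<Longrightarrow> set (xs i) = pverts (\<Gamma> i)"
      and distinct_xs: "\<And>i. i \<in> {1..l} \<Longrightarrow> distinct (xs i)"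
    using finite_distinct_list[OF finite_verts] by metis
  have enum: "distinct (list_Sigma is xs)" "set (list_Sigma is xs) = pverts \<Gamma>\<^sub>J"
    unfolding pverts_graph_join set_list_Sigma using "is" distinct_xs xs
    by (intro distinct_list_Sigma Sigma_cong; simp)+
  note card_Pic0 = J.card_Pic0_eq_det[OF enum connected_join[OF assms]]
  show "finite (carrier (Pic0 \<Gamma>\<^sub>J))"
    by (rule card_Pic0(1))
  show "(of_nat (card (pverts \<Gamma>\<^sub>J)))\<^sup>2 * of_nat (card (carrier (Pic0 \<Gamma>\<^sub>J))) =
      of_nat (card (pverts \<Gamma>\<^sub>J)) ^ l *
      (\<Prod>i=1..l. \<bar>poly (graph_char_poly (\<Gamma> i))
        (of_nat (card (pverts (\<Gamma> i))) - of_nat (card (pverts \<Gamma>\<^sub>J)))\<bar>)"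
    using card_Pic0(2) abs_det_shifted_laplacian_join[of "is" xs 0] "is" xs distinct_xs
      connected_imp_pverts_nonempty[OF conn] by simp
qed

end

theorem theoremC:
  fixes l :: nat and \<Gamma> :: "nat \<Rightarrow> 'a pair_pre_digraph"
  assumes "l \<ge> 1"
    and "\<And>i. i \<in> {1..l} \<Longrightarrow> pair_graph (\<Gamma> i)"
    and "\<And>i. i \<in> {1..l} \<Longrightarrow> pverts (\<Gamma> i) \<noteq> {}"
    and "\<And>i. i \<in> {1..l} \<Longrightarrow> Digraph_Component.connected (with_proj (\<Gamma> i))"
  defines "k \<equiv> \<lambda>i. card (pverts (\<Gamma> i))"
  defines "K \<equiv> \<Sum>i=1..l. k i"
  shows "finite (carrier (Pic0 (graph_join l \<Gamma>)))
    \<and> (of_nat (card (carrier (Pic0 (graph_join l \<Gamma>)))) :: rat)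
      = of_nat K powi (int l - 2)
        * (\<Prod>i=1..l. \<bar>poly (graph_char_poly (\<Gamma> i)) (of_nat (k i) - of_nat K)\<bar>)"
proof -
  interpret pair_graph_family l \<Gamma>
    using assms(2) by (rule pair_graph_family.intro)
  have K: "card (pverts (graph_join l \<Gamma>)) = K"
    by (simp only: card_verts_join K_def k_def)
  have "K > 0"
    using assms(1,3) finite_verts unfolding K_def k_def
    by (intro sum_pos) (auto simp: card_gt_0_iff)
  then have "(of_nat K :: rat) ^ l = (of_nat K)\<^sup>2 * of_nat K powi (int l - 2)"
    by (simp add: power_int_diff)
  then show ?thesis
    using card_Pic0_join[OF assms(1,4)] \<open>K > 0\<close> unfolding K k_def by (simp add: mult.assoc)
qed

end
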